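(* Let $X$ and $Y$ be locally realcompact spaces, neither of which is realcompact. If $(\mathscr{R}(X),\leq)$ and $(\mathscr{R}(Y),\leq)$ are order-isomorphic, then $\mathrm{cl}_{\beta X}(\upsilon X\setminus X)$ and $\mathrm{cl}_{\beta Y}(\upsilon Y\setminus Y)$ are homeomorphic.
   Context: All spaces are completely regular Hausdorff. $\beta X$ is the Stone–Čech compactification and $\upsilon X\subseteq\beta X$ the Hewitt realcompactification of $X$. An extension of $X$ is a space containing $X$ as a dense subspace; its remainder is $Y\setminus X$. Extensions are identified up to homeomorphisms fixing $X$ pointwise, and $Y\leq Y'$ means there is a continuous map $Y'\to Y$ fixing $X$ pointwise. A space is realcompact if it is homeomorphic to a closed subspace of a power of $\mathbb{R}$; $X$ is locally realcompact if every point has an open neighborhood with realcompact closure. $\mathscr{R}(X)$ denotes the set of all realcompact extensions of $X$ with compact remainder, partially ordered by $\leq$. *)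

theory Defs
  imports "HOL-Analysis.Analysis"
begin

text \<open>Realcompact: homeomorphic to a closed subspace of a power of the reals.
  The index set is taken inside the type of real-valued functions on the
  carrier type; this is no restriction (every realcompact space embeds as a
  closed subspace of the power indexed by its continuous real functions).\<close>
definition realcompact :: "'a topology \<Rightarrow> bool" where
  "realcompact X \<longleftrightarrow>
     (\<exists>(I::('a \<Rightarrow> real) set) (f::'a \<Rightarrow> ('a \<Rightarrow> real) \<Rightarrow> real).
        embedding_map X (product_topology (\<lambda>_. euclideanreal) I) f \<and>
        closedin (product_topology (\<lambda>_. euclideanreal) I) (f ` topspace X))"

definition locally_realcompact :: "'a topology \<Rightarrow> bool" where
  "locally_realcompact X \<longleftrightarrow>
     (\<forall>x\<in>topspace X. \<exists>U. openin X U \<and> x \<in> U \<and>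
        realcompact (subtopology X (X closure_of U)))"

definition is_extension :: "'a topology \<Rightarrow> 'e topology \<Rightarrow> ('a \<Rightarrow> 'e) \<Rightarrow> bool" where
  "is_extension X T e \<longleftrightarrow>
     completely_regular_space T \<and> Hausdorff_space T \<and>
     embedding_map X T e \<and> T closure_of (e ` topspace X) = topspace T"

text \<open>Extensions are represented on the carrier type 'a set set, which is large
  enough to hold a copy of every Hausdorff space containing a dense copy of X.\<close>
type_synonym 'a ext = "'a set set topology \<times> ('a \<Rightarrow> 'a set set)"

definition ext_le :: "'a topology \<Rightarrow> 'a ext \<Rightarrow> 'a ext \<Rightarrow> bool" where
  "ext_le X E E' \<longleftrightarrow>
     (\<exists>g. continuous_map (fst E') (fst E) g \<and>
          (\<forall>x\<in>topspace X. g (snd E' x) = snd E x))"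

definition ext_equiv :: "'a topology \<Rightarrow> ('a ext \<times> 'a ext) set" where
  "ext_equiv X =
     {(E, E'). \<exists>g. homeomorphic_map (fst E') (fst E) g \<and>
          (\<forall>x\<in>topspace X. g (snd E' x) = snd E x)}"

definition RC_ext :: "'a topology \<Rightarrow> 'a ext set" where
  "RC_ext X = {(T, e). is_extension X T e \<and> realcompact T \<and>
                       compactin T (topspace T - e ` topspace X)}"

definition RC_classes :: "'a topology \<Rightarrow> 'a ext set set" where
  "RC_classes X = RC_ext X // (ext_equiv X \<inter> (RC_ext X \<times> RC_ext X))"

definition class_le :: "'a topology \<Rightarrow> 'a ext set \<Rightarrow> 'a ext set \<Rightarrow> bool" where
  "class_le X A B \<longleftrightarrow> (\<exists>E\<in>A. \<exists>E'\<in>B. ext_le X E E')"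

definition RC_order_isomorphic :: "'a topology \<Rightarrow> 'b topology \<Rightarrow> bool" where
  "RC_order_isomorphic X Y \<longleftrightarrow>
     (\<exists>\<phi>. bij_betw \<phi> (RC_classes X) (RC_classes Y) \<and>
        (\<forall>A\<in>RC_classes X. \<forall>B\<in>RC_classes X. class_le X A B \<longleftrightarrow> class_le Y (\<phi> A) (\<phi> B)))"

definition stone_cech :: "'a topology \<Rightarrow> 'c topology \<Rightarrow> ('a \<Rightarrow> 'c) \<Rightarrow> bool" where
  "stone_cech X B b \<longleftrightarrow> is_extension X B b \<and> compact_space B \<and>
     (\<forall>f. continuous_map X euclideanreal f \<and> bounded (f ` topspace X) \<longrightarrow>
        (\<exists>g. continuous_map B euclideanreal g \<and> (\<forall>x\<in>topspace X. g (b x) = f x)))"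

definition hewitt_in :: "'a topology \<Rightarrow> 'c topology \<Rightarrow> ('a \<Rightarrow> 'c) \<Rightarrow> 'c set \<Rightarrow> bool" where
  "hewitt_in X B b U \<longleftrightarrow> b ` topspace X \<subseteq> U \<and> U \<subseteq> topspace B \<and>
     realcompact (subtopology B U) \<and>
     (\<forall>f. continuous_map X euclideanreal f \<longrightarrow>
        (\<exists>g. continuous_map (subtopology B U) euclideanreal g \<and>
             (\<forall>x\<in>topspace X. g (b x) = f x)))"

end

theory Submission
  imports Defs
begin

text \<open>
  A point \<open>p\<close> of the Stone-Cech compactification \<open>B\<close> determines the filter \<open>tr p\<close> of traces of its
  neighbourhoods on \<open>X\<close>. A realcompact extension \<open>T\<close> with compact remainder is encoded by the relation
  of all pairs \<open>(p, q)\<close> whose traces converge in \<open>T\<close> to the same point of the remainder. These are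
  exactly the closed symmetric transitive relations on \<open>B - X\<close> whose field contains
  \<open>K = cl (U - X)\<close>, where \<open>U\<close> is the Hewitt realcompactification, and \<open>T \<le> T'\<close> becomes reverse
  inclusion. In this poset of relations the members living on \<open>K\<close> can be recognised by their order
  properties; they are the closed equivalence relations on \<open>K\<close>, and as in Magill's theorem these
  determine \<open>K\<close>: the atoms are the pairs of points, three pairs form a triangle iff each is below
  the join of the other two, and the closed sets are the classes of closed equivalence relations.
\<close>

section \<open>Realcompactness in terms of filters\<close>

text \<open>In general \<open>B\<close> has no map to an extension \<open>T\<close>, since a trace
  may have no limit there. Hence the relations are only partial equivalences, and a partially
  defined limit map with closed images replaces the quotient map. Compactness of the remainder makes
  the relation closed. Realcompactness of \<open>T\<close> gives a limit to the trace at every new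
  point of \<open>U\<close>, because all real functions on \<open>X\<close> converge along it, and
  closedness spreads this to \<open>K\<close>. Local realcompactness keeps \<open>K\<close> away
  from \<open>X\<close>, so that \<open>Id_on K\<close> is admissible, and it is the least relation.
  Conversely, if the field contains \<open>K\<close>, a filter on which all real functions converge
  and which stays away from the compact remainder can be pulled back to \<open>X\<close>; its limit
  in \<open>B\<close> lies in \<open>U\<close>, hence over \<open>T\<close>. The obstacle in the
  order argument is that a field may exceed \<open>K\<close>, and enlarging the field and gluing
  points are both mere inclusions. They differ in one way: an added point must be present before it
  can be glued, whereas two points of \<open>K\<close> can be glued at once.\<close>

lemma limitin_compose_continuous_map:
  assumes "continuous_map X Y f" "limitin X m x F"
  shows "limitin Y (\<lambda>i. f (m i)) (f x) F"
proof -
  have x: "x \<in> topspace X"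
    using assms(2) limitin_topspace by fastforce
  have "\<forall>\<^sub>F i in F. f (m i) \<in> U" if "openin Y U" "f x \<in> U" for U
  proof -
    have "openin X {z \<in> topspace X. f z \<in> U}"
      using assms(1) that(1) openin_continuous_map_preimage by blast
    then have "\<forall>\<^sub>F i in F. m i \<in> {z \<in> topspace X. f z \<in> U}"
      using assms(2) x that by (intro limitinD) auto
    then show ?thesis
      by (rule eventually_mono) auto
  qed
  moreover have "f x \<in> topspace Y"
    using assms(1) x by (meson continuous_map_image_subset_topspace image_subset_iff)
  ultimately show ?thesis
    by (simp add: limitin_def)
qed

lemma embedding_map_limitin_iff:
  assumes "embedding_map X Y f" "\<forall>\<^sub>F i in F. m i \<in> topspace X" "x \<in> topspace X"
  shows "limitin Y (\<lambda>i. f (m i)) (f x) F \<longleftrightarrow> limitin X m x F"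
proof
  assume L: "limitin Y (\<lambda>i. f (m i)) (f x) F"
  obtain g where g: "continuous_map (subtopology Y (f ` topspace X)) X g"
    "\<And>x. x \<in> topspace X \<Longrightarrow> g (f x) = x"
    using assms(1) by (auto simp: embedding_map_def homeomorphic_map_maps homeomorphic_maps_def)
  have "\<forall>\<^sub>F i in F. f (m i) \<in> f ` topspace X"
    using assms(2) by (rule eventually_mono) auto
  then have "limitin (subtopology Y (f ` topspace X)) (\<lambda>i. f (m i)) (f x) F"
    using L assms(3) by (simp add: limitin_subtopology)
  then have "limitin X (\<lambda>i. g (f (m i))) (g (f x)) F"
    by (rule limitin_compose_continuous_map[OF g(1)])
  moreover have "\<forall>\<^sub>F i in F. g (f (m i)) = m i"
    using assms(2) by (rule eventually_mono) (simp add: g)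
  ultimately show "limitin X m x F"
    using g(2)[OF assms(3)] limitin_transform_eventually by fastforce
next
  assume "limitin X m x F"
  moreover have "continuous_map X Y f"
    using assms(1) continuous_map_in_subtopology embedding_map_def homeomorphic_imp_continuous_map by blast
  ultimately show "limitin Y (\<lambda>i. f (m i)) (f x) F"
    by (rule limitin_compose_continuous_map[rotated])
qed

text \<open>The coordinates of the embedding are continuous real functions, so \<open>m\<close>
  converges in the power of the reals; closedness of the image brings the limit back to
  \<open>Z\<close>.\<close>

lemma realcompact_imp_convergent:
  assumes "realcompact Z" "F \<noteq> bot" "\<forall>\<^sub>F i in F. m i \<in> topspace Z"
    and "\<And>f. continuous_map Z euclideanreal f \<Longrightarrow> \<exists>r. ((\<lambda>i. f (m i)) \<longlongrightarrow> r) F"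
  shows "\<exists>z. limitin Z m z F"
proof -
  obtain I :: "('a \<Rightarrow> real) set" and e
    where e: "embedding_map Z (product_topology (\<lambda>_. euclideanreal) I) e"
      and cl: "closedin (product_topology (\<lambda>_. euclideanreal) I) (e ` topspace Z)"
    using assms(1) unfolding realcompact_def by blast
  let ?P = "product_topology (\<lambda>_. euclideanreal) I"
  have ce: "continuous_map Z ?P e"
    using e continuous_map_in_subtopology embedding_map_def homeomorphic_imp_continuous_map by blast
  have "continuous_map Z euclideanreal (\<lambda>z. e z j)" if "j \<in> I" for j
    using ce that by (simp add: continuous_map_componentwise)
  then have "\<exists>r. ((\<lambda>i. e (m i) j) \<longlongrightarrow> r) F" if "j \<in> I" for j
    using assms(4) that by blast
  then obtain r where r: "\<And>j. j \<in> I \<Longrightarrow> ((\<lambda>i. e (m i) j) \<longlongrightarrow> r j) F"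
    by metis
  have ev: "\<forall>\<^sub>F i in F. e (m i) \<in> e ` topspace Z"
    using assms(3) by (rule eventually_mono) auto
  have "limitin ?P (\<lambda>i. e (m i)) (restrict r I) F"
    unfolding limitin_componentwise
  proof (intro conjI ballI)
    show "\<forall>\<^sub>F a in F. e (m a) \<in> topspace ?P"
      using ev by (rule eventually_mono) (use ce continuous_map_image_subset_topspace in blast)
  qed (use r in auto)
  then obtain z where z: "z \<in> topspace Z" "limitin ?P (\<lambda>i. e (m i)) (e z) F"
    using limitin_closedin[OF _ cl ev] assms(2) by (metis imageE)
  then show ?thesis
    using embedding_map_limitin_iff[OF e assms(3)] by blast
qed

lemma completely_regular_space_bump:
  assumes "completely_regular_space T" "openin T U" "c \<in> U"
  obtains f where "continuous_map T euclideanreal f" "f ` topspace T \<subseteq> {0..1::real}"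
    "f c = 0" "\<forall>t\<in>topspace T - U. f t = 1"
proof -
  have "closedin T (topspace T - U) \<and> c \<in> topspace T - (topspace T - U)"
    using assms openin_subset by fastforce
  then have "\<exists>f. continuous_map T (top_of_set {0..1::real}) f \<and> f c = 0 \<and> f ` (topspace T - U) \<subseteq> {1}"
    using assms(1)[unfolded completely_regular_space_def, rule_format] by blast
  then obtain f where f: "continuous_map T (top_of_set {0..1::real}) f" "f c = 0" "f ` (topspace T - U) \<subseteq> {1}"
    by blast
  show ?thesis
    by (rule that[of f]) (use f in \<open>auto simp: continuous_map_in_subtopology\<close>)
qed

text \<open>The filter lives on the carrier of \<open>X\<close>, so its convergence can be tested in
  every extension of \<open>X\<close> without a map between that extension and \<open>B\<close>. The
  principal part discards points outside \<open>X\<close>, where \<open>b\<close> is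
  arbitrary.\<close>

definition trace_filter :: "'a topology \<Rightarrow> 'b topology \<Rightarrow> ('a \<Rightarrow> 'b) \<Rightarrow> 'b \<Rightarrow> 'a filter" where
  "trace_filter X B b p = inf (filtercomap b (nhdsin B p)) (principal (topspace X))"

lemma eventually_trace_filter:
  assumes "p \<in> topspace B"
  shows "eventually Q (trace_filter X B b p) \<longleftrightarrow>
    (\<exists>V. openin B V \<and> p \<in> V \<and> (\<forall>x\<in>topspace X. b x \<in> V \<longrightarrow> Q x))" (is "?L \<longleftrightarrow> ?R")
proof
  assume ?L
  then obtain R S where "openin B S" "p \<in> S" "\<forall>x\<in>S. R x" "\<forall>x. R (b x) \<longrightarrow> x \<in> topspace X \<longrightarrow> Q x"
    using assms unfolding trace_filter_def eventually_inf_principal eventually_filtercomap eventually_nhdsin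
    by auto
  then show ?R by (intro exI[of _ S]) auto
next
  assume ?R
  then obtain V where "openin B V" "p \<in> V" "\<forall>x\<in>topspace X. b x \<in> V \<longrightarrow> Q x" by auto
  then show ?L
    unfolding trace_filter_def eventually_inf_principal eventually_filtercomap eventually_nhdsin
    by (intro exI[of _ "\<lambda>y. y \<in> V"]) auto
qed

lemma trace_filter_topspace:
  assumes "p \<in> topspace B"
  shows "\<forall>\<^sub>F x in trace_filter X B b p. x \<in> topspace X"
  unfolding eventually_trace_filter[OF assms] using assms by (intro exI[of _ "topspace B"]) auto

lemma trace_filter_limitin:
  assumes "p \<in> topspace B"
  shows "limitin B b p (trace_filter X B b p)"
  unfolding limitin_def using assms by (auto simp: eventually_trace_filter)

lemma trace_filter_nonbot:
  assumes "p \<in> B closure_of (b ` topspace X)"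
  shows "trace_filter X B b p \<noteq> bot"
proof -
  have "p \<in> topspace B"
    using assms by (simp add: in_closure_of)
  then show ?thesis
    using assms unfolding trivial_limit_def by (auto simp: eventually_trace_filter in_closure_of)
qed

text \<open>The Tychonoff embedding: bump functions separate points, and a single coordinate, the
  bump at \<open>x\<close> inside \<open>V\<close>, already gives a neighbourhood of the image of
  \<open>x\<close> that pulls back into \<open>V\<close>.\<close>

lemma completely_regular_space_function_embedding:
  fixes Z :: "'a topology"
  assumes cr: "completely_regular_space Z" and hd: "Hausdorff_space Z"
  defines "I \<equiv> {f. continuous_map Z euclideanreal f}"
  shows "embedding_map Z (product_topology (\<lambda>_. euclideanreal) I) (\<lambda>z. restrict (\<lambda>f. f z) I)"
proof -
  let ?e = "\<lambda>z. restrict (\<lambda>f. f z) I"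
  let ?P = "product_topology (\<lambda>_. euclideanreal) I"
  have ce: "continuous_map Z ?P ?e"
    by (auto simp: continuous_map_componentwise I_def)
  have "?e x \<noteq> ?e y" if xy: "x \<in> topspace Z" "y \<in> topspace Z" "x \<noteq> y" for x y
  proof -
    have o: "openin Z (topspace Z - {y})" "x \<in> topspace Z - {y}"
      using hd xy by (simp_all add: closedin_Hausdorff_singleton openin_diff)
    obtain f where f: "continuous_map Z euclideanreal f" "f ` topspace Z \<subseteq> {0..1}" "f x = 0"
      "\<forall>t\<in>topspace Z - (topspace Z - {y}). f t = 1"
      by (rule completely_regular_space_bump[OF cr o])
    then have "f y = 1"
      using xy by blast
    then show ?thesis
      using f unfolding I_def by (metis mem_Collect_eq restrict_apply' zero_neq_one)
  qed
  then have inj: "inj_on ?e (topspace Z)"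
    by (meson inj_onI)
  let ?g = "inv_into (topspace Z) ?e"
  have g: "?g (?e x) = x" if "x \<in> topspace Z" for x
    using inj that by (rule inv_into_f_f)
  have "continuous_map (subtopology ?P (?e ` topspace Z)) Z ?g"
    unfolding continuous_map_eq_topcontinuous_at topcontinuous_at_def
  proof (intro conjI ballI allI impI)
    fix p assume p: "p \<in> topspace (subtopology ?P (?e ` topspace Z))"
    then obtain x where x: "x \<in> topspace Z" "p = ?e x" by auto
    show "p \<in> topspace (subtopology ?P (?e ` topspace Z))" by fact
    show "?g \<in> topspace (subtopology ?P (?e ` topspace Z)) \<rightarrow> topspace Z"
      using g by auto
    fix V assume V: "openin Z V \<and> ?g p \<in> V"
    then have V': "openin Z V" "x \<in> V"
      using x g by auto
    obtain f where f: "continuous_map Z euclideanreal f" "f ` topspace Z \<subseteq> {0..1}" "f x = 0"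
      "\<forall>z\<in>topspace Z - V. f z = 1"
      using completely_regular_space_bump[OF cr V'] by blast
    then have fI: "f \<in> I" by (simp add: I_def)
    have "openin ?P {p \<in> topspace ?P. p f \<in> {..<1}}"
      by (rule openin_continuous_map_preimage[OF continuous_map_product_projection[OF fI]]) auto
    then have o: "openin (subtopology ?P (?e ` topspace Z)) ({p \<in> topspace ?P. p f \<in> {..<1}} \<inter> ?e ` topspace Z)"
      by (rule openin_subtopology_Int)
    show "\<exists>U. openin (subtopology ?P (?e ` topspace Z)) U \<and> p \<in> U \<and> (\<forall>y\<in>U. ?g y \<in> V)"
    proof (intro exI conjI, rule o)
      show "p \<in> {p \<in> topspace ?P. p f \<in> {..<1}} \<inter> ?e ` topspace Z"
        using p x f(3) fI by auto
      show "\<forall>y\<in>{p \<in> topspace ?P. p f \<in> {..<1}} \<inter> ?e ` topspace Z. ?g y \<in> V"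
      proof
        fix y assume "y \<in> {p \<in> topspace ?P. p f \<in> {..<1}} \<inter> ?e ` topspace Z"
        then obtain z where z: "z \<in> topspace Z" "y = ?e z" "f z < 1"
          using fI by auto
        then have "z \<in> V"
          using f(4) by force
        then show "?g y \<in> V"
          using g z by simp
      qed
    qed
  qed
  then show ?thesis
    unfolding embedding_map_def homeomorphic_map_maps homeomorphic_maps_def
    using ce g by (intro exI[of _ ?g]) (auto simp: continuous_map_in_subtopology)
qed

text \<open>A point \<open>p\<close> in the closure of the Tychonoff image has a trace filter on
  \<open>Z\<close>, along which each function \<open>f\<close> converges to the coordinate
  \<open>p f\<close>. The assumed limit in \<open>Z\<close> is then mapped to \<open>p\<close>, so
  the image is closed.\<close>

lemma realcompactI_convergent:
  fixes Z :: "'a topology"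
  assumes cr: "completely_regular_space Z" and hd: "Hausdorff_space Z"
    and conv: "\<And>F. \<lbrakk>F \<noteq> bot; \<forall>\<^sub>F z in F. z \<in> topspace Z;
      \<And>f. continuous_map Z euclideanreal f \<Longrightarrow> \<exists>r. (f \<longlongrightarrow> r) F\<rbrakk> \<Longrightarrow> \<exists>z. limitin Z (\<lambda>z. z) z F"
  shows "realcompact Z"
proof -
  define I where "I = {f. continuous_map Z euclideanreal f}"
  define e where "e = (\<lambda>z. restrict (\<lambda>f. f z) I)"
  let ?P = "product_topology (\<lambda>_. euclideanreal) I"
  have emb: "embedding_map Z ?P e"
    using completely_regular_space_function_embedding[OF cr hd] by (simp add: e_def I_def)
  have hP: "Hausdorff_space ?P"
    by (simp add: Hausdorff_space_product_topology)
  have "?P closure_of (e ` topspace Z) \<subseteq> e ` topspace Z"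
  proof
    fix p assume p: "p \<in> ?P closure_of (e ` topspace Z)"
    define F where "F = trace_filter Z ?P e p"
    have pt: "p \<in> topspace ?P"
      using p by (simp add: in_closure_of)
    have ne: "F \<noteq> bot" and ev: "\<forall>\<^sub>F z in F. z \<in> topspace Z" and lim: "limitin ?P e p F"
      unfolding F_def using p pt trace_filter_nonbot trace_filter_topspace trace_filter_limitin by metis+
    have "\<exists>r. (f \<longlongrightarrow> r) F" if "continuous_map Z euclideanreal f" for f
    proof -
      have fI: "f \<in> I" using that by (simp add: I_def)
      then have "limitin euclideanreal (\<lambda>c. e c f) (p f) F"
        using lim unfolding limitin_componentwise by blast
      then show ?thesis
        using fI by (auto simp: e_def)
    qed
    then obtain z where z: "limitin Z (\<lambda>z. z) z F"
      using conv ne ev by blast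
    then have zt: "z \<in> topspace Z" by (rule limitin_topspace)
    have "limitin ?P e (e z) F"
      using embedding_map_limitin_iff[OF emb ev zt] z by simp
    then have "p = e z"
      using limitin_Hausdorff_unique lim ne hP by metis
    then show "p \<in> e ` topspace Z" using zt by blast
  qed
  moreover have "e ` topspace Z \<subseteq> topspace ?P"
    by (auto simp: e_def)
  ultimately have "closedin ?P (e ` topspace Z)"
    using closure_of_subset_eq by blast
  then show ?thesis
    unfolding realcompact_def using emb by blast
qed

text \<open>If no point of \<open>C\<close> is a limit, each has a neighbourhood that the filter
  eventually avoids. Finitely many of them cover \<open>C\<close>, and the filter eventually lies in
  a closed set disjoint from \<open>C\<close>, to which Urysohn's lemma applies.\<close>

lemma compactin_limit_or_separated:
  fixes m :: "'i \<Rightarrow> 'a"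
  assumes cr: "completely_regular_space T" and C: "compactin T C"
    and ev: "\<forall>\<^sub>F i in F. m i \<in> topspace T"
    and conv: "\<And>f. \<lbrakk>continuous_map T euclideanreal f; bounded (f ` topspace T)\<rbrakk>
        \<Longrightarrow> \<exists>r. ((\<lambda>i. f (m i)) \<longlongrightarrow> r) F"
  obtains c where "c \<in> C" "limitin T m c F"
  | h W where "continuous_map T euclideanreal h" "bounded (h ` topspace T)" "openin T W" "C \<subseteq> W"
      "\<And>t. t \<in> W \<Longrightarrow> h t = 0" "\<forall>\<^sub>F i in F. h (m i) = 1"
proof (cases "\<exists>c\<in>C. limitin T m c F")
  case True then show ?thesis using that by blast
next
  case False
  have "\<exists>W. openin T W \<and> c \<in> W \<and> (\<forall>\<^sub>F i in F. m i \<notin> W)" if "c \<in> C" for c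
  proof -
    have ct: "c \<in> topspace T" using C that compactin_subset_topspace by blast
    have "\<not> limitin T m c F" using False \<open>c \<in> C\<close> by blast
    then obtain U where U: "openin T U" "c \<in> U" "\<not> (\<forall>\<^sub>F i in F. m i \<in> U)"
      using ct by (auto simp: limitin_def)
    obtain f where cf: "continuous_map T euclideanreal f" and f01: "f ` topspace T \<subseteq> {0..1}"
      and f: "f c = 0" "\<forall>t\<in>topspace T - U. f t = 1"
      using completely_regular_space_bump[OF cr U(1,2)] by blast
    then have "bounded (f ` topspace T)"
      by (meson bounded_closed_interval bounded_subset)
    then obtain r where r: "((\<lambda>i. f (m i)) \<longlongrightarrow> r) F"
      using conv cf by blast
    \<comment> \<open>Failure of convergence only says that \<open>m\<close> is not eventually in
      \<open>U\<close>. Since the values of \<open>f\<close> have a limit, that limit is at least 1,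
      and so \<open>m\<close> is eventually outside the smaller set where \<open>f\<close> is below
      1/2.\<close>
    have "r \<ge> 1"
    proof (rule ccontr)
      assume "\<not> r \<ge> 1"
      then have "\<forall>\<^sub>F i in F. f (m i) < 1"
        using r by (intro order_tendstoD) auto
      then have "\<forall>\<^sub>F i in F. m i \<in> U"
        using ev by eventually_elim (use f(2) in force)
      then show False using U by blast
    qed
    then have "\<forall>\<^sub>F i in F. f (m i) > 1/2"
      using r by (intro order_tendstoD) auto
    then have "\<forall>\<^sub>F i in F. m i \<notin> {t \<in> topspace T. f t \<in> {..<1/2}}"
      by (rule eventually_mono) auto
    moreover have "openin T {t \<in> topspace T. f t \<in> {..<1/2}}"
      by (rule openin_continuous_map_preimage[OF cf]) auto
    ultimately show ?thesis
      using ct f(1) by (intro exI[of _ "{t \<in> topspace T. f t \<in> {..<1/2}}"]) auto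
  qed
  then obtain W where W: "\<And>c. c \<in> C \<Longrightarrow> openin T (W c) \<and> c \<in> W c \<and> (\<forall>\<^sub>F i in F. m i \<notin> W c)"
    by metis
  have "\<exists>\<F>. finite \<F> \<and> \<F> \<subseteq> W ` C \<and> C \<subseteq> \<Union>\<F>"
    using W by (intro compactinD[OF C]) auto
  then obtain \<F> where \<F>: "finite \<F>" "\<F> \<subseteq> W ` C" "C \<subseteq> \<Union>\<F>"
    by blast
  define S where "S = topspace T - \<Union>\<F>"
  have "openin T (\<Union>\<F>)"
    using \<F>(2) W by (intro openin_Union) auto
  then have S: "closedin T S" "disjnt S C"
    using \<F>(3) by (auto simp: S_def disjnt_iff)
  have "\<forall>\<^sub>F i in F. \<forall>U\<in>\<F>. m i \<notin> U"
    using \<F> W by (intro eventually_ball_finite) auto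
  then have evS: "\<forall>\<^sub>F i in F. m i \<in> S"
    using ev by eventually_elim (auto simp: S_def)
  obtain h where h: "continuous_map T (top_of_set {0..1::real}) h" "h ` C \<subseteq> {0}" "h ` S \<subseteq> {1}"
    using Urysohn_completely_regular_closed_compact[OF _ cr S(1) C S(2), of 0 1] by auto
  have ch: "continuous_map T euclideanreal h" and h01: "h ` topspace T \<subseteq> {0..1}"
    using h(1) by (auto simp: continuous_map_in_subtopology)
  \<comment> \<open>\<open>h\<close> is only known to vanish on \<open>C\<close>. Cutting it off
    below 1/2 makes it vanish on a neighbourhood, so that products with it can later be continued by
    zero.\<close>
  show ?thesis
  proof (rule that(2)[of "\<lambda>t. max 0 (2 * h t - 1)" "{t \<in> topspace T. h t \<in> {..<1/2}}"])
    show "continuous_map T euclideanreal (\<lambda>t. max 0 (2 * h t - 1))"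
      by (intro continuous_intros ch)
    show "bounded ((\<lambda>t. max 0 (2 * h t - 1)) ` topspace T)"
      by (rule bounded_subset[of "{0..1}"]) (use h01 in auto)
    show "openin T {t \<in> topspace T. h t \<in> {..<1/2}}"
      by (rule openin_continuous_map_preimage[OF ch]) auto
    show "C \<subseteq> {t \<in> topspace T. h t \<in> {..<1/2}}"
      using h(2) C compactin_subset_topspace by fastforce
    show "\<forall>\<^sub>F i in F. max 0 (2 * h (m i) - 1) = 1"
      using evS by (rule eventually_mono) (use h(3) in auto)
  qed auto
qed

section \<open>Extensions and the relations they induce on the Stone-Cech compactification\<close>

locale stone_cech_space =
  fixes X :: "'a topology" and B :: "'c topology" and b :: "'a \<Rightarrow> 'c"
  assumes completely_regular: "completely_regular_space X"
    and Hausdorff: "Hausdorff_space X"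
    and stone_cech: "stone_cech X B b"
begin

abbreviation tr :: "'c \<Rightarrow> 'a filter" where
  "tr \<equiv> trace_filter X B b"

lemma compact_B: "compact_space B" and Hausdorff_B: "Hausdorff_space B"
  and completely_regular_B: "completely_regular_space B"
  and embedding_b: "embedding_map X B b" and dense_b: "B closure_of (b ` topspace X) = topspace B"
  using stone_cech by (auto simp: stone_cech_def is_extension_def)

lemma continuous_b: "continuous_map X B b"
  using embedding_b continuous_map_in_subtopology embedding_map_def homeomorphic_imp_continuous_map by blast

lemma b_in_topspace: "x \<in> topspace X \<Longrightarrow> b x \<in> topspace B"
  using continuous_b continuous_map_image_subset_topspace by blast

lemma tr_nonbot: "p \<in> topspace B \<Longrightarrow> tr p \<noteq> bot"
  by (simp add: trace_filter_nonbot dense_b)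

lemma tr_topspace: "p \<in> topspace B \<Longrightarrow> \<forall>\<^sub>F x in tr p. x \<in> topspace X"
  by (rule trace_filter_topspace)

lemma tr_limitin: "p \<in> topspace B \<Longrightarrow> limitin B b p (tr p)"
  by (rule trace_filter_limitin)

lemma tr_limitin_eq:
  assumes "p \<in> topspace B" "limitin B b q (tr p)"
  shows "q = p"
  using limitin_Hausdorff_unique[OF assms(2) tr_limitin[OF assms(1)]] tr_nonbot[OF assms(1)] Hausdorff_B by simp

text \<open>Stated for functions on a part \<open>S\<close> of \<open>B\<close> because it serves
  both bounded functions (\<open>S\<close> is all of \<open>B\<close>) and arbitrary ones
  (\<open>S\<close> is the Hewitt realcompactification).\<close>

lemma tr_tendsto:
  assumes g: "continuous_map (subtopology B S) euclideanreal g" and "b ` topspace X \<subseteq> S"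
    and p: "p \<in> topspace B" "p \<in> S" and f: "\<And>x. x \<in> topspace X \<Longrightarrow> g (b x) = f x"
  shows "(f \<longlongrightarrow> g p) (tr p)"
proof -
  have "\<forall>\<^sub>F x in tr p. b x \<in> S"
    using tr_topspace[OF p(1)] by (rule eventually_mono) (use assms(2) in blast)
  then have "limitin (subtopology B S) b p (tr p)"
    using p tr_limitin by (simp add: limitin_subtopology)
  then have "limitin euclideanreal (\<lambda>x. g (b x)) (g p) (tr p)"
    by (rule limitin_compose_continuous_map[OF g])
  moreover have "\<forall>\<^sub>F x in tr p. g (b x) = f x"
    using tr_topspace[OF p(1)] by (rule eventually_mono) (use f in blast)
  ultimately show ?thesis
    using limitin_transform_eventually limitin_canonical_iff by fast
qed

lemma limitin_tr_b:
  assumes "x \<in> topspace X"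
  shows "limitin X (\<lambda>x. x) x (tr (b x))"
  using embedding_map_limitin_iff[OF embedding_b tr_topspace assms] tr_limitin b_in_topspace[OF assms] by metis

lemma limitin_tr_imp_eq_b:
  assumes "p \<in> topspace B" "limitin X (\<lambda>x. x) x (tr p)"
  shows "p = b x"
proof -
  have "limitin B b (b x) (tr p)"
    using limitin_compose_continuous_map[OF continuous_b assms(2)] .
  then show ?thesis
    using tr_limitin_eq[OF assms(1)] by metis
qed

text \<open>The diagonal part records which points of \<open>B\<close> lie over the remainder of
  \<open>T\<close>; points whose trace has no limit in \<open>T\<close> are not related to
  anything.\<close>

definition lim_rel :: "'e topology \<Rightarrow> ('a \<Rightarrow> 'e) \<Rightarrow> ('c \<times> 'c) set" where
  "lim_rel T e = {(p, q). p \<in> topspace B \<and> q \<in> topspace B \<and>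
     (\<exists>t\<in>topspace T - e ` topspace X. limitin T e t (tr p) \<and> limitin T e t (tr q))}"

end

locale stone_cech_extension = stone_cech_space X B b
  for X :: "'a topology" and B :: "'c topology" and b +
  fixes T :: "'e topology" and e :: "'a \<Rightarrow> 'e"
  assumes extension: "is_extension X T e"
begin

lemma completely_regular_T: "completely_regular_space T" and Hausdorff_T: "Hausdorff_space T"
  and embedding_e: "embedding_map X T e" and dense_e: "T closure_of (e ` topspace X) = topspace T"
  using extension by (auto simp: is_extension_def)

lemma continuous_e: "continuous_map X T e"
  using embedding_e continuous_map_in_subtopology embedding_map_def homeomorphic_imp_continuous_map by blast

lemma e_in_topspace: "x \<in> topspace X \<Longrightarrow> e x \<in> topspace T"
  using continuous_e continuous_map_image_subset_topspace by blast

lemma limitin_e_b: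
  assumes "x \<in> topspace X"
  shows "limitin T e (e x) (tr (b x))"
  using limitin_compose_continuous_map[OF continuous_e limitin_tr_b[OF assms]] .

lemma limitin_e_imp_eq_b:
  assumes "x \<in> topspace X" "p \<in> topspace B" "limitin T e (e x) (tr p)"
  shows "p = b x"
  using embedding_map_limitin_iff[OF embedding_e tr_topspace assms(1)] assms limitin_tr_imp_eq_b by blast

lemma limitin_e_unique:
  assumes "p \<in> topspace B" "limitin T e s (tr p)" "limitin T e t (tr p)"
  shows "s = t"
  using limitin_Hausdorff_unique[OF assms(2,3)] tr_nonbot[OF assms(1)] Hausdorff_T by simp

text \<open>This stands in for a map from \<open>B\<close> to \<open>T\<close>: \<open>f\<close>
  restricted to \<open>X\<close> is bounded and extends to \<open>B\<close>, and the extension takes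
  the value \<open>f t\<close> at every point whose trace converges to \<open>t\<close>.\<close>

lemma bounded_function_lift:
  assumes f: "continuous_map T euclideanreal f" "bounded (f ` topspace T)"
  obtains g where "continuous_map B euclideanreal g"
    "\<forall>p\<in>topspace B. ((\<lambda>x. f (e x)) \<longlongrightarrow> g p) (tr p)"
    "\<forall>p\<in>topspace B. \<forall>t. limitin T e t (tr p) \<longrightarrow> g p = f t"
proof -
  have "continuous_map X euclideanreal (\<lambda>x. f (e x))"
    using continuous_map_compose[OF continuous_e f(1)] by (simp add: o_def)
  moreover have "bounded ((\<lambda>x. f (e x)) ` topspace X)"
    by (rule bounded_subset[OF f(2)]) (use e_in_topspace in auto)
  ultimately obtain g where g: "continuous_map B euclideanreal g" "\<forall>x\<in>topspace X. g (b x) = f (e x)"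
    using stone_cech unfolding stone_cech_def by metis
  have lim: "((\<lambda>x. f (e x)) \<longlongrightarrow> g p) (tr p)" if "p \<in> topspace B" for p
    using tr_tendsto[of "topspace B" g p "\<lambda>x. f (e x)"] g that b_in_topspace by auto
  moreover have "g p = f t" if "p \<in> topspace B" "limitin T e t (tr p)" for p t
  proof -
    have "((\<lambda>x. f (e x)) \<longlongrightarrow> f t) (tr p)"
      using limitin_compose_continuous_map[OF f(1) that(2)] by simp
    then show ?thesis
      using tendsto_unique[OF tr_nonbot[OF that(1)]] lim that(1) by blast
  qed
  ultimately show ?thesis
    using that g(1) by blast
qed

text \<open>The dichotomy for the trace at \<open>p\<close>, with the separating function moved to
  \<open>B\<close>: it is 1 at \<open>p\<close> and 0 at all points of \<open>B\<close> lying over a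
  neighbourhood of \<open>C\<close>.\<close>

lemma compactin_limit_or_separated:
  assumes C: "compactin T C" and p: "p \<in> topspace B"
  obtains c where "c \<in> C" "limitin T e c (tr p)"
  | g W where "continuous_map B euclideanreal g" "g p = (1::real)" "openin T W" "C \<subseteq> W"
     "\<forall>q\<in>topspace B. \<forall>t\<in>W. limitin T e t (tr q) \<longrightarrow> g q = 0"
proof -
  have ev: "\<forall>\<^sub>F x in tr p. e x \<in> topspace T"
    using tr_topspace[OF p] by (rule eventually_mono) (rule e_in_topspace)
  show ?thesis
  proof (rule compactin_limit_or_separated[OF completely_regular_T C ev])
    show "\<exists>r. ((\<lambda>x. f (e x)) \<longlongrightarrow> r) (tr p)"
      if f: "continuous_map T euclideanreal f" "bounded (f ` topspace T)" for f
      by (rule bounded_function_lift[OF f]) (use p in blast)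
  next
    fix h W assume h: "continuous_map T euclideanreal h" "bounded (h ` topspace T)" "openin T W" "C \<subseteq> W"
      "\<And>t. t \<in> W \<Longrightarrow> h t = 0" "\<forall>\<^sub>F i in tr p. h (e i) = 1"
    obtain g where g: "continuous_map B euclideanreal g"
      "\<forall>p\<in>topspace B. ((\<lambda>x. h (e x)) \<longlongrightarrow> g p) (tr p)"
      "\<forall>p\<in>topspace B. \<forall>t. limitin T e t (tr p) \<longrightarrow> g p = h t"
      by (rule bounded_function_lift[OF h(1,2)])
    have "((\<lambda>x. h (e x)) \<longlongrightarrow> 1) (tr p)"
      using h(6) by (rule tendsto_eventually)
    then have "g p = 1"
      using tendsto_unique[OF tr_nonbot[OF p]] bspec[OF g(2) p] by metis
    then show thesis
      using that(2)[of g W] g h by simp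
  qed (use that in blast)
qed

text \<open>The partial limit map from \<open>B\<close> to \<open>T\<close> behaves like a closed
  map. A point \<open>t\<close> outside the image is separated from each \<open>p\<close> in
  \<open>A\<close>; compactness of \<open>A\<close> leaves finitely many separations, whose
  neighbourhoods of \<open>t\<close> are intersected.\<close>

lemma closedin_limit_image:
  assumes "closedin B A"
  shows "closedin T {t. \<exists>p\<in>A. limitin T e t (tr p)}" (is "closedin T ?S")
proof -
  have A: "compactin B A" "A \<subseteq> topspace B"
    using assms compact_B closedin_compact_space closedin_subset by blast+
  have "\<exists>W. openin T W \<and> t \<in> W \<and> W \<subseteq> topspace T - ?S" if t: "t \<in> topspace T - ?S" for t
  proof -
    have C: "compactin T {t}" using t by simp
    have "\<exists>g W. continuous_map B euclideanreal g \<and> g p = (1::real) \<and> openin T W \<and> t \<in> W \<and>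
       (\<forall>q\<in>topspace B. \<forall>s\<in>W. limitin T e s (tr q) \<longrightarrow> g q = 0)" if p: "p \<in> A" for p
    proof -
      have pB: "p \<in> topspace B" using p A by blast
      show ?thesis
        by (rule compactin_limit_or_separated[OF C pB]) (use t p in blast)+
    qed
    then obtain g W where gW: "\<And>p. p \<in> A \<Longrightarrow> continuous_map B euclideanreal (g p) \<and> g p p = (1::real) \<and>
       openin T (W p) \<and> t \<in> W p \<and> 
       (\<forall>q\<in>topspace B. \<forall>s\<in>W p. limitin T e s (tr q) \<longrightarrow> g p q = 0)"
      by metis
    define V where "V p = {q \<in> topspace B. g p q \<in> {1/2<..}}" for p
    have Vo: "openin B (V p)" if "p \<in> A" for p
      unfolding V_def by (rule openin_continuous_map_preimage[of B euclideanreal]) (use gW that in auto)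
    have "\<exists>\<F>. finite \<F> \<and> \<F> \<subseteq> V ` A \<and> A \<subseteq> \<Union>\<F>"
      using Vo gW A by (intro compactinD[OF A(1)]) (auto simp: V_def)
    then obtain P where P: "finite P" "P \<subseteq> A" "A \<subseteq> \<Union>(V ` P)"
      by (metis finite_subset_image)
    define W' where "W' = topspace T \<inter> \<Inter>(W ` P)"
    have "openin T W'"
      unfolding W'_def using P gW by (intro openin_Int_Inter) auto
    moreover have "t \<in> W'"
      using t P gW by (auto simp: W'_def)
    moreover have "s \<notin> ?S" if s: "s \<in> W'" for s
    proof
      assume "s \<in> ?S"
      then obtain q where q: "q \<in> A" "limitin T e s (tr q)" by blast
      then obtain p where p: "p \<in> P" "q \<in> V p" using P by blast
      then have "g p q = 0"
        using gW[of p] q s P(2) A(2) unfolding W'_def by blast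
      then show False using p by (simp add: V_def)
    qed
    ultimately show ?thesis
      by (intro exI[of _ W']) (auto simp: W'_def)
  qed
  then have "openin T (topspace T - ?S)"
    by (subst openin_subopen) blast
  moreover have "?S \<subseteq> topspace T"
    using limitin_topspace by fastforce
  ultimately show ?thesis
    by (simp add: closedin_def)
qed

text \<open>The limit image of \<open>B\<close> is closed and contains the dense copy of
  \<open>X\<close>.\<close>

lemma limit_image_topspace:
  assumes "t \<in> topspace T"
  obtains p where "p \<in> topspace B" "limitin T e t (tr p)"
proof -
  have "e ` topspace X \<subseteq> {t. \<exists>p\<in>topspace B. limitin T e t (tr p)}"
    using limitin_e_b b_in_topspace by blast
  then have "T closure_of (e ` topspace X) \<subseteq> {t. \<exists>p\<in>topspace B. limitin T e t (tr p)}"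
    by (intro closure_of_minimal closedin_limit_image) auto
  then show ?thesis
    using assms that dense_e by blast
qed

lemma sym_lim_rel: "sym (lim_rel T e)"
  by (auto simp: lim_rel_def sym_def)

lemma trans_lim_rel: "trans (lim_rel T e)"
  unfolding trans_def lim_rel_def using limitin_e_unique by blast

lemma lim_rel_subset: "lim_rel T e \<subseteq> (topspace B - b ` topspace X) \<times> (topspace B - b ` topspace X)"
proof -
  have "p \<notin> b ` topspace X"
    if p: "p \<in> topspace B" "limitin T e t (tr p)" "t \<in> topspace T - e ` topspace X" for p t
    using limitin_e_b limitin_e_unique[OF p(1)] p by blast
  then show ?thesis
    unfolding lim_rel_def by blast
qed

text \<open>Compactness of the remainder keeps the limit points of \<open>?H\<close> in
  \<open>?H\<close>. Once both coordinates have limits in the remainder, lifted bump functions show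
  that these limits coincide.\<close>

lemma closedin_lim_rel:
  assumes C: "compactin T (topspace T - e ` topspace X)"
  shows "closedin (prod_topology B B) (lim_rel T e)"
proof -
  let ?C = "topspace T - e ` topspace X"
  let ?H = "{p \<in> topspace B. \<exists>t\<in>?C. limitin T e t (tr p)}"
  let ?P = "prod_topology B B"
  have fst: "continuous_map ?P euclideanreal (\<lambda>z. g (fst z))" and snd: "continuous_map ?P euclideanreal (\<lambda>z. g (snd z))"
    if "continuous_map B euclideanreal g" for g
    using continuous_map_compose[OF continuous_map_fst that] continuous_map_compose[OF continuous_map_snd that]
    by (simp_all add: o_def)
  \<comment> \<open>Closedness of \<open>?H\<close> in functional form: if the trace at
    \<open>z\<close> had no limit in \<open>?C\<close>, the separating function would vanish on
    \<open>?H\<close> but be 1 at \<open>z\<close>.\<close>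
  have clH: "z \<in> ?H" if z: "z \<in> topspace B" and g0: "\<And>g. \<lbrakk>continuous_map B euclideanreal g; \<And>q. q \<in> ?H \<Longrightarrow> g q = 0\<rbrakk> \<Longrightarrow> g z = 0" for z
  proof (rule compactin_limit_or_separated[OF C z])
    fix c assume "c \<in> ?C" "limitin T e c (tr z)"
    then show ?thesis using z by blast
  next
    fix g W assume g: "continuous_map B euclideanreal g" "g z = 1" "?C \<subseteq> W"
      "\<forall>q\<in>topspace B. \<forall>t\<in>W. limitin T e t (tr q) \<longrightarrow> g q = 0"
    then have "g q = 0" if "q \<in> ?H" for q
      using that by blast
    then have "g z = 0"
      by (rule g0[OF g(1)])
    then show ?thesis using g(2) by simp
  qed
  have "?P closure_of (lim_rel T e) \<subseteq> lim_rel T e"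
  proof (rule subrelI)
    fix p q assume pq: "(p, q) \<in> ?P closure_of (lim_rel T e)"
    then have pqB: "p \<in> topspace B" "q \<in> topspace B"
      by (auto simp: in_closure_of)
    \<comment> \<open>Used three times: with one function zero, to place each coordinate in
      \<open>?H\<close>, and with both equal, to identify the two limits.\<close>
    have eq: "g (fst (p, q)) = g' (snd (p, q))" if "continuous_map B euclideanreal g" "continuous_map B euclideanreal g'"
      "\<And>u v. (u, v) \<in> lim_rel T e \<Longrightarrow> g u = g' v" for g g'
      using forall_in_closure_of_eq[OF pq Hausdorff_space_euclidean fst[OF that(1)] snd[OF that(2)]] that(3) by auto
    have "p \<in> ?H"
    proof (rule clH[OF pqB(1)])
      fix g assume "continuous_map B euclideanreal g" "\<And>q. q \<in> ?H \<Longrightarrow> g q = 0"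
      then show "g p = 0"
        using eq[of g "\<lambda>_. 0"] by (force simp: lim_rel_def)
    qed
    moreover have "q \<in> ?H"
    proof (rule clH[OF pqB(2)])
      fix g assume "continuous_map B euclideanreal g" "\<And>q. q \<in> ?H \<Longrightarrow> g q = 0"
      then show "g q = 0"
        using eq[of "\<lambda>_. 0" g] by (force simp: lim_rel_def)
    qed
    ultimately obtain s t where st: "s \<in> ?C" "limitin T e s (tr p)" "t \<in> ?C" "limitin T e t (tr q)"
      by blast
    have "s = t"
    proof (rule ccontr)
      assume "s \<noteq> t"
      then have o: "openin T (topspace T - {t})" "s \<in> topspace T - {t}"
        using st Hausdorff_T by (auto simp: closedin_Hausdorff_singleton openin_diff)
      obtain f where f: "continuous_map T euclideanreal f" "f ` topspace T \<subseteq> {0..1::real}"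
        "f s = 0" "\<forall>u\<in>topspace T - (topspace T - {t}). f u = 1"
        using completely_regular_space_bump[OF completely_regular_T o] by blast
      have bf: "bounded (f ` topspace T)"
        using f(2) by (meson bounded_closed_interval bounded_subset)
      obtain g where g: "continuous_map B euclideanreal g"
        "\<forall>p\<in>topspace B. ((\<lambda>x. f (e x)) \<longlongrightarrow> g p) (tr p)"
        "\<forall>p\<in>topspace B. \<forall>t. limitin T e t (tr p) \<longrightarrow> g p = f t"
        by (rule bounded_function_lift[OF f(1) bf])
      have "g u = g v" if "(u, v) \<in> lim_rel T e" for u v
        using that g(3) unfolding lim_rel_def by auto
      then have "g (fst (p, q)) = g (snd (p, q))"
        by (rule eq[OF g(1) g(1)])
      then have "g p = g q"
        by simp
      then have "f s = f t"
        using g(3) st pqB by metis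
      then show False
        using f st by auto
    qed
    then show "(p, q) \<in> lim_rel T e"
      using st pqB unfolding lim_rel_def by blast
  qed
  moreover have "lim_rel T e \<subseteq> topspace ?P"
    using lim_rel_subset by auto
  ultimately show ?thesis
    using closure_of_subset_eq by blast
qed

end

section \<open>Maps between extensions as inclusions of relations\<close>

context stone_cech_space
begin

text \<open>A map fixing \<open>X\<close> carries limits of traces to limits of traces and remainder
  points to remainder points. Conversely the relations dictate the map: its value at
  \<open>t\<close> is the limit in \<open>T\<close> of any trace converging to \<open>t\<close> in
  \<open>T'\<close>.\<close>

lemma extension_map_iff_lim_rel_subset:
  assumes T: "is_extension X T e" and T': "is_extension X T' e'"
  shows "(\<exists>g. continuous_map T' T g \<and> (\<forall>x\<in>topspace X. g (e' x) = e x)) \<longleftrightarrow> lim_rel T' e' \<subseteq> lim_rel T e"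
proof -
  interpret T: stone_cech_extension X B b T e by unfold_locales fact
  interpret T': stone_cech_extension X B b T' e' by unfold_locales fact
  show ?thesis
  proof
    assume "\<exists>g. continuous_map T' T g \<and> (\<forall>x\<in>topspace X. g (e' x) = e x)"
    then obtain g where g: "continuous_map T' T g" "\<And>x. x \<in> topspace X \<Longrightarrow> g (e' x) = e x"
      by blast
    have lim: "limitin T e (g t) (tr p)" if "p \<in> topspace B" "limitin T' e' t (tr p)" for p t
    proof -
      have "limitin T (\<lambda>x. g (e' x)) (g t) (tr p)"
        by (rule limitin_compose_continuous_map[OF g(1) that(2)])
      moreover have "\<forall>\<^sub>F x in tr p. g (e' x) = e x"
        using tr_topspace[OF that(1)] by (rule eventually_mono) (rule g(2))
      ultimately show ?thesis
        using limitin_transform_eventually by fast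
    qed
    \<comment> \<open>A trace converging to \<open>e x\<close> in \<open>T\<close> can only be the
      one at \<open>b x\<close>, whose limit in \<open>T'\<close> is \<open>e' x\<close>; so a
      remainder point is not sent into the copy of \<open>X\<close>.\<close>
    have rem: "g t \<in> topspace T - e ` topspace X"
      if p: "p \<in> topspace B" "limitin T' e' t (tr p)" and t: "t \<in> topspace T' - e' ` topspace X" for p t
    proof -
      have "g t \<noteq> e x" if x: "x \<in> topspace X" for x
      proof
        assume "g t = e x"
        then have "p = b x"
          using lim[OF p] T.limitin_e_imp_eq_b[OF x p(1)] by simp
        then have "t = e' x"
          using T'.limitin_e_b[OF x] T'.limitin_e_unique p by metis
        then show False using t x by blast
      qed
      then show ?thesis
        using limitin_topspace[OF lim[OF p]] by blast
    qed
    show "lim_rel T' e' \<subseteq> lim_rel T e"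
    proof (rule subrelI)
      fix p q assume "(p, q) \<in> lim_rel T' e'"
      then obtain t where t: "p \<in> topspace B" "q \<in> topspace B" "t \<in> topspace T' - e' ` topspace X"
        "limitin T' e' t (tr p)" "limitin T' e' t (tr q)"
        unfolding lim_rel_def by blast
      then show "(p, q) \<in> lim_rel T e"
        unfolding lim_rel_def using lim rem[OF t(1,4,3)] by blast
    qed
  next
    assume sub: "lim_rel T' e' \<subseteq> lim_rel T e"
    \<comment> \<open>At a remainder point the inclusion of relations, applied to a diagonal pair,
      gives existence of \<open>s\<close>; applied to the other pairs, it gives independence of the
      chosen trace.\<close>
    have "\<exists>s. \<forall>p\<in>topspace B. limitin T' e' t (tr p) \<longrightarrow> limitin T e s (tr p)" if t: "t \<in> topspace T'" for t
    proof (cases "t \<in> e' ` topspace X")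
      case True
      then obtain x where x: "x \<in> topspace X" "t = e' x" by blast
      then show ?thesis
        using T'.limitin_e_imp_eq_b T.limitin_e_b by blast
    next
      case False
      obtain p where p: "p \<in> topspace B" "limitin T' e' t (tr p)"
        using T'.limit_image_topspace[OF t] .
      have rel: "(p, q) \<in> lim_rel T e" if "q \<in> topspace B" "limitin T' e' t (tr q)" for q
      proof -
        have "(p, q) \<in> lim_rel T' e'"
          unfolding lim_rel_def using p t that False by blast
        then show ?thesis using sub by blast
      qed
      obtain s where s: "limitin T e s (tr p)"
        using rel[OF p] unfolding lim_rel_def by blast
      have "limitin T e s (tr q)" if "q \<in> topspace B" "limitin T' e' t (tr q)" for q
        using rel[OF that] T.limitin_e_unique[OF p(1) s] unfolding lim_rel_def by blast
      then show ?thesis by blast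
    qed
    then obtain g where g: "\<And>t p. \<lbrakk>t \<in> topspace T'; p \<in> topspace B; limitin T' e' t (tr p)\<rbrakk> \<Longrightarrow> limitin T e (g t) (tr p)"
      by metis
    have gT: "g t \<in> topspace T" if t: "t \<in> topspace T'" for t
    proof -
      obtain p where p: "p \<in> topspace B" "limitin T' e' t (tr p)"
        using T'.limit_image_topspace[OF t] .
      show ?thesis
        using limitin_topspace[OF g[OF t p]] .
    qed
    have "continuous_map T' T g"
      unfolding continuous_map_eq_topcontinuous_at topcontinuous_at_def
    proof (intro conjI ballI allI impI)
      fix t V assume t: "t \<in> topspace T'" and V: "openin T V \<and> g t \<in> V"
      obtain f where f: "continuous_map T euclideanreal f" "f ` topspace T \<subseteq> {0..1::real}"
        "f (g t) = 0" "\<forall>u\<in>topspace T - V. f u = 1"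
        using completely_regular_space_bump[OF T.completely_regular_T] V by blast
      have bf: "bounded (f ` topspace T)"
        using f(2) by (meson bounded_closed_interval bounded_subset)
      obtain h where h: "continuous_map B euclideanreal h"
        "\<forall>p\<in>topspace B. ((\<lambda>x. f (e x)) \<longlongrightarrow> h p) (tr p)"
        "\<forall>p\<in>topspace B. \<forall>t. limitin T e t (tr p) \<longrightarrow> h p = f t"
        by (rule T.bounded_function_lift[OF f(1) bf])
      \<comment> \<open>The lifted bump is 0 over \<open>t\<close> and 1 over points sent outside
        \<open>V\<close>. The limit image of \<open>A\<close> in \<open>T'\<close> is closed, and
        its complement is the required neighbourhood of \<open>t\<close>.\<close>
      define A where "A = {p \<in> topspace B. h p \<in> {1/2..}}"
      have "closedin B A"
        unfolding A_def by (rule closedin_continuous_map_preimage[OF h(1)]) auto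
      then have "openin T' (topspace T' - {t. \<exists>p\<in>A. limitin T' e' t (tr p)})" (is "openin T' ?W")
        using T'.closedin_limit_image by blast
      moreover have "t \<in> ?W"
      proof -
        have "\<not> limitin T' e' t (tr p)" if "p \<in> A" for p
        proof
          assume lim: "limitin T' e' t (tr p)"
          have "p \<in> topspace B"
            using that by (simp add: A_def)
          then have "h p = 0"
            using g[OF t _ lim] h(3) f(3) by metis
          then show False using that by (simp add: A_def)
        qed
        then show ?thesis using t by blast
      qed
      moreover have "g s \<in> V" if s: "s \<in> ?W" for s
      proof (rule ccontr)
        assume sV: "g s \<notin> V"
        have sT: "s \<in> topspace T'" using s by blast
        obtain p where p: "p \<in> topspace B" "limitin T' e' s (tr p)"
          using T'.limit_image_topspace[OF sT] .
        have "h p = f (g s)"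
          using h(3) g[OF sT p] p(1) by blast
        also have "\<dots> = 1"
          using f(4) sV gT[OF sT] by blast
        finally have "p \<in> A"
          using p(1) by (simp add: A_def)
        then show False using s p by blast
      qed
      ultimately show "\<exists>W. openin T' W \<and> t \<in> W \<and> (\<forall>y\<in>W. g y \<in> V)"
        by blast
    qed (use gT in auto)
    moreover have "g (e' x) = e x" if x: "x \<in> topspace X" for x
      using g[OF T'.e_in_topspace[OF x] b_in_topspace[OF x] T'.limitin_e_b[OF x]]
        T.limitin_e_b[OF x] T.limitin_e_unique[OF b_in_topspace[OF x]] by metis
    ultimately show "\<exists>g. continuous_map T' T g \<and> (\<forall>x\<in>topspace X. g (e' x) = e x)"
      by blast
  qed
qed

lemma extension_self_map_eq_id:
  assumes T: "is_extension X T e" and f: "continuous_map T T f" "\<And>x. x \<in> topspace X \<Longrightarrow> f (e x) = e x"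
    and t: "t \<in> topspace T"
  shows "f t = t"
proof -
  have "t \<in> T closure_of (e ` topspace X)" "Hausdorff_space T"
    using T t by (auto simp: is_extension_def)
  then show ?thesis
    using forall_in_closure_of_eq[of t T "e ` topspace X" T f "\<lambda>x. x"] f by auto
qed

text \<open>Equal relations give maps in both directions; their composites fix the dense copy of
  \<open>X\<close> and are therefore identities.\<close>

lemma extension_homeomorphism_iff_lim_rel_eq:
  assumes T: "is_extension X T e" and T': "is_extension X T' e'"
  shows "(\<exists>g. homeomorphic_map T' T g \<and> (\<forall>x\<in>topspace X. g (e' x) = e x)) \<longleftrightarrow> lim_rel T' e' = lim_rel T e"
proof
  assume "\<exists>g. homeomorphic_map T' T g \<and> (\<forall>x\<in>topspace X. g (e' x) = e x)"
  then obtain g h where gh: "homeomorphic_maps T' T g h" "\<forall>x\<in>topspace X. g (e' x) = e x"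
    using homeomorphic_map_maps by blast
  have "e' x \<in> topspace T'" if "x \<in> topspace X" for x
    using T' that unfolding is_extension_def embedding_map_def homeomorphic_eq_everything_map by auto
  then have "\<forall>x\<in>topspace X. h (e x) = e' x"
    using gh unfolding homeomorphic_maps_def by metis
  then show "lim_rel T' e' = lim_rel T e"
    using gh extension_map_iff_lim_rel_subset[OF T T'] extension_map_iff_lim_rel_subset[OF T' T]
    unfolding homeomorphic_maps_def by blast
next
  assume "lim_rel T' e' = lim_rel T e"
  then obtain g h where gh: "continuous_map T' T g" "\<forall>x\<in>topspace X. g (e' x) = e x"
    "continuous_map T T' h" "\<forall>x\<in>topspace X. h (e x) = e' x"
    using extension_map_iff_lim_rel_subset[OF T T'] extension_map_iff_lim_rel_subset[OF T' T] by blast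
  have "h (g t) = t" if "t \<in> topspace T'" for t
    using extension_self_map_eq_id[OF T', of "h \<circ> g" t] gh that continuous_map_compose by (metis o_apply)
  moreover have "g (h t) = t" if "t \<in> topspace T" for t
    using extension_self_map_eq_id[OF T, of "g \<circ> h" t] gh that continuous_map_compose by (metis o_apply)
  ultimately have "homeomorphic_maps T' T g h"
    using gh by (simp add: homeomorphic_maps_def)
  then show "\<exists>g. homeomorphic_map T' T g \<and> (\<forall>x\<in>topspace X. g (e' x) = e x)"
    using gh(2) homeomorphic_map_maps by blast
qed

end

section \<open>The Hewitt realcompactification\<close>

text \<open>The quotient topology on the values of \<open>\<tau>\<close>. The saturation of a closed
  set is a projection along a compact factor, so \<open>\<tau>\<close> is closed; normality and T1
  pass through closed maps and give the Hausdorff property.\<close>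

lemma closed_equivalence_quotient:
  fixes \<tau> :: "'c \<Rightarrow> 'd"
  assumes comp: "compact_space B" and haus: "Hausdorff_space B"
    and ker: "closedin (prod_topology B B) {(p, q). p \<in> topspace B \<and> q \<in> topspace B \<and> \<tau> p = \<tau> q}"
      (is "closedin _ ?R")
  obtains Q where "topspace Q = \<tau> ` topspace B" "continuous_map B Q \<tau>" "closed_map B Q \<tau>"
    "compact_space Q" "Hausdorff_space Q"
proof -
  let ?pre = "\<lambda>S. {p \<in> topspace B. \<tau> p \<in> S}"
  let ?L = "\<lambda>S. S \<subseteq> \<tau> ` topspace B \<and> openin B (?pre S)"
  have "istopology ?L"
    unfolding istopology_def
  proof (intro conjI allI impI)
    fix S T assume "?L S" "?L T"
    then have "openin B (?pre S \<inter> ?pre T)" by blast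
    moreover have "?pre S \<inter> ?pre T = ?pre (S \<inter> T)" by blast
    ultimately show "openin B (?pre (S \<inter> T))" by simp
  next
    fix \<K> assume "\<forall>K\<in>\<K>. ?L K"
    then have "openin B (\<Union>(?pre ` \<K>))" by blast
    moreover have "\<Union>(?pre ` \<K>) = ?pre (\<Union>\<K>)" by blast
    ultimately show "openin B (?pre (\<Union>\<K>))" by simp
  qed blast+
  define Q where "Q = topology ?L"
  have oQ: "openin Q = ?L"
    unfolding Q_def by (rule topology_inverse') fact
  have "openin Q (\<tau> ` topspace B)"
  proof -
    have "?pre (\<tau> ` topspace B) = topspace B" by blast
    then show ?thesis unfolding oQ by simp
  qed
  moreover have "openin Q (topspace Q)" by simp
  ultimately have tQ: "topspace Q = \<tau> ` topspace B"
    using openin_subset[of Q] unfolding oQ by blast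
  have cont: "continuous_map B Q \<tau>"
    unfolding continuous_map_def using tQ oQ by auto
  have closed: "closed_map B Q \<tau>"
    unfolding closed_map_def
  proof (intro allI impI)
    fix A assume A: "closedin B A"
    then have AB: "A \<subseteq> topspace B" by (rule closedin_subset)
    have "closedin (prod_topology B B) (?R \<inter> (A \<times> topspace B))"
      using ker A by (intro closedin_Int) (auto simp: closedin_prod_Times_iff)
    then have "closedin B (snd ` (?R \<inter> (A \<times> topspace B)))"
      using Abstract_Topological_Spaces.closed_map_snd[OF comp, of B] unfolding closed_map_def by blast
    moreover have "snd ` (?R \<inter> (A \<times> topspace B)) = ?pre (\<tau> ` A)"
    proof (intro equalityI subsetI)
      fix q assume "q \<in> ?pre (\<tau> ` A)"
      then obtain p where "p \<in> A" "q \<in> topspace B" "\<tau> q = \<tau> p" by blast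
      then have "(p, q) \<in> ?R \<inter> (A \<times> topspace B)" using AB by auto
      then show "q \<in> snd ` (?R \<inter> (A \<times> topspace B))" by (rule rev_image_eqI) simp
    qed (auto intro: rev_image_eqI)
    ultimately have "openin B (topspace B - ?pre (\<tau> ` A))" by auto
    moreover have "topspace B - ?pre (\<tau> ` A) = ?pre (topspace Q - \<tau> ` A)"
      using tQ by blast
    ultimately have "openin Q (topspace Q - \<tau> ` A)"
      unfolding oQ using tQ by auto
    then show "closedin Q (\<tau> ` A)"
      using AB tQ by (auto simp: closedin_def)
  qed
  have "compact_space Q"
    using image_compactin[OF _ cont, of "topspace B"] comp tQ by (simp add: compact_space_def)
  moreover have "Hausdorff_space Q"
  proof -
    have "normal_space Q"
      using normal_space_continuous_closed_map_image[OF _ cont closed] tQ comp haus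
        compact_Hausdorff_or_regular_imp_normal_space by blast
    moreover have "t1_space Q"
      using t1_space_closed_map_image[OF closed] tQ haus Hausdorff_imp_t1_space by blast
    ultimately show ?thesis
      by (rule normal_t1_imp_Hausdorff_space)
  qed
  ultimately show ?thesis
    using that tQ cont closed by blast
qed

section \<open>The set \<open>K\<close> and the admissible relations\<close>

locale hewitt_space = stone_cech_space X B b
  for X :: "'a topology" and B :: "'c topology" and b +
  fixes U :: "'c set"
  assumes hewitt: "hewitt_in X B b U"
    and locally_realcompact: "locally_realcompact X"
    and not_realcompact: "\<not> realcompact X"
begin

lemma U_subset: "U \<subseteq> topspace B" and b_subset_U: "b ` topspace X \<subseteq> U"
  and realcompact_U: "realcompact (subtopology B U)"
  using hewitt by (auto simp: hewitt_in_def)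

lemma topspace_U: "topspace (subtopology B U) = U"
  using U_subset by auto

lemma function_extends_to_U:
  assumes "continuous_map X euclideanreal f"
  obtains g where "continuous_map (subtopology B U) euclideanreal g" "\<forall>x\<in>topspace X. g (b x) = f x"
  using hewitt assms unfolding hewitt_in_def by metis

text \<open>Real functions on \<open>U\<close> restrict along \<open>b\<close> to real functions on
  \<open>X\<close>, so convergence of the latter suffices for realcompactness of \<open>U\<close> to
  yield a limit.\<close>

lemma convergent_in_U:
  assumes "F \<noteq> bot" and m: "\<forall>\<^sub>F i in F. m i \<in> topspace X"
    and conv: "\<And>f. continuous_map X euclideanreal f \<Longrightarrow> \<exists>r. ((\<lambda>i. f (m i)) \<longlongrightarrow> r) F"
  obtains u where "u \<in> U" "limitin B (\<lambda>i. b (m i)) u F"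
proof -
  have "\<exists>z. limitin (subtopology B U) (\<lambda>i. b (m i)) z F"
  proof (rule realcompact_imp_convergent[OF realcompact_U assms(1)])
    show "\<forall>\<^sub>F i in F. b (m i) \<in> topspace (subtopology B U)"
      using m by (rule eventually_mono) (use b_subset_U topspace_U in blast)
    show "\<exists>r. ((\<lambda>i. f (b (m i))) \<longlongrightarrow> r) F" if f: "continuous_map (subtopology B U) euclideanreal f" for f
    proof (rule conv)
      have "continuous_map X (subtopology B U) b"
        using continuous_b b_subset_U by (auto simp: continuous_map_in_subtopology)
      then show "continuous_map X euclideanreal (\<lambda>x. f (b x))"
        using continuous_map_compose[OF _ f] by (auto simp: o_def)
    qed
  qed
  then show ?thesis
    using that unfolding limitin_subtopology by blast
qed

lemma tr_tendsto_U:
  assumes "p \<in> U" "continuous_map X euclideanreal f"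
  shows "\<exists>r. (f \<longlongrightarrow> r) (tr p)"
proof -
  obtain g where g: "continuous_map (subtopology B U) euclideanreal g" "\<forall>x\<in>topspace X. g (b x) = f x"
    using function_extends_to_U[OF assms(2)] .
  have "p \<in> topspace B" using assms(1) U_subset by blast
  then have "(f \<longlongrightarrow> g p) (tr p)"
    using tr_tendsto[OF g(1) b_subset_U _ assms(1)] g(2) by blast
  then show ?thesis ..
qed

definition K :: "'c set" where
  "K = B closure_of (U - b ` topspace X)"

lemma closedin_K: "closedin B K"
  by (simp add: K_def)

lemma U_subset_K: "U - b ` topspace X \<subseteq> K"
  unfolding K_def using U_subset by (intro closure_of_subset) auto

text \<open>Otherwise \<open>U\<close> would add no points to \<open>X\<close>, and its
  realcompactness would pass to \<open>X\<close>. A point of \<open>K\<close> is needed later as a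
  partner for gluing points outside \<open>K\<close>.\<close>

lemma K_nonempty: "K \<noteq> {}"
proof
  assume "K = {}"
  then have U: "U \<subseteq> b ` topspace X"
    using U_subset_K by blast
  have "realcompact X"
  proof (rule realcompactI_convergent[OF completely_regular Hausdorff])
    fix F assume F: "F \<noteq> bot" "\<forall>\<^sub>F x in F. x \<in> topspace X"
      "\<And>f. continuous_map X euclideanreal f \<Longrightarrow> \<exists>r. (f \<longlongrightarrow> r) F"
    obtain u where u: "u \<in> U" "limitin B b u F"
      using convergent_in_U[OF F(1,2)] F(3) by blast
    then obtain x where x: "x \<in> topspace X" "u = b x"
      using U by blast
    then show "\<exists>z. limitin X (\<lambda>z. z) z F"
      using embedding_map_limitin_iff[OF embedding_b F(2) x(1)] u by metis
  qed
  then show False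
    using not_realcompact by simp
qed

text \<open>Near a point of \<open>X\<close> the space \<open>U\<close> has no new points: a cutoff function turns continuous
  functions on a realcompact neighbourhood into continuous functions on \<open>X\<close>, so traces of points
  of \<open>U\<close> converge inside that neighbourhood.\<close>
lemma K_disjoint: "K \<inter> b ` topspace X = {}"
proof -
  have "b x \<notin> K" if x: "x \<in> topspace X" for x
  proof -
    obtain W where W: "openin X W" "x \<in> W" and rc: "realcompact (subtopology X (X closure_of W))"
      using locally_realcompact x unfolding locally_realcompact_def by blast
    let ?A = "X closure_of W"
    have WA: "W \<subseteq> ?A"
      using W(1) by (simp add: closure_of_subset openin_subset)
    have "openin (subtopology B (b ` topspace X)) (b ` W)"
      using embedding_b W(1) unfolding embedding_map_def homeomorphic_eq_everything_map open_map_def by blast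
    then obtain V where V: "openin B V" "b ` W = V \<inter> b ` topspace X"
      unfolding openin_subtopology by blast
    have inj: "inj_on b (topspace X)"
      using embedding_b unfolding embedding_map_def homeomorphic_eq_everything_map by blast
    have WV: "y \<in> W \<longleftrightarrow> b y \<in> V" if "y \<in> topspace X" for y
      using V(2) that inj openin_subset[OF W(1)] by (auto simp: inj_on_def image_iff set_eq_iff)
    have "p \<in> b ` topspace X" if p: "p \<in> V" "p \<in> U" for p
    proof -
      have pB: "p \<in> topspace B" using p U_subset by blast
      obtain f where f: "continuous_map B euclideanreal f" "f ` topspace B \<subseteq> {0..1::real}"
        "f p = 0" "\<forall>t\<in>topspace B - V. f t = 1"
        by (rule completely_regular_space_bump[OF completely_regular_B V(1) p(1)])
      define \<phi> where "\<phi> = (\<lambda>y. 1 - f (b y))"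
      have c\<phi>: "continuous_map X euclideanreal \<phi>"
        unfolding \<phi>_def using continuous_map_compose[OF continuous_b f(1)]
        by (intro continuous_intros) (simp add: o_def)
      have "limitin euclideanreal (\<lambda>y. f (b y)) (f p) (tr p)"
        by (rule limitin_compose_continuous_map[OF f(1) tr_limitin[OF pB]])
      then have lim\<phi>: "(\<phi> \<longlongrightarrow> 1) (tr p)"
        unfolding \<phi>_def using f(3) by (auto intro!: tendsto_eq_intros)
      have evV: "\<forall>\<^sub>F y in tr p. b y \<in> V"
        using limitinD[OF tr_limitin[OF pB] V(1) p(1)] .
      have evW: "\<forall>\<^sub>F y in tr p. y \<in> W"
        using evV tr_topspace[OF pB] by eventually_elim (simp add: WV)
      have "\<exists>z. limitin (subtopology X ?A) (\<lambda>y. y) z (tr p)"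
      proof (rule realcompact_imp_convergent[OF rc tr_nonbot[OF pB]])
        show "\<forall>\<^sub>F y in tr p. y \<in> topspace (subtopology X ?A)"
          using evW tr_topspace[OF pB] by eventually_elim (use WA in auto)
        fix g assume g: "continuous_map (subtopology X ?A) euclideanreal g"
        define h where "h = (\<lambda>y. if y \<in> W then \<phi> y * g y else 0)"
        have "continuous_map X euclideanreal h"
          unfolding h_def
        proof (rule continuous_map_cases)
          show "continuous_map (subtopology X (X closure_of {y. y \<in> W})) euclideanreal (\<lambda>y. \<phi> y * g y)"
            using g continuous_map_from_subtopology[OF c\<phi>] by (auto intro!: continuous_map_real_mult)
          fix y assume "y \<in> X frontier_of {y. y \<in> W}"
          then have "y \<in> topspace X" "y \<notin> W"
            using W(1) by (auto simp: frontier_of_def interior_of_openin in_closure_of)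
          then have "\<phi> y = 0"
            using f(4) WV b_in_topspace by (simp add: \<phi>_def)
          then show "\<phi> y * g y = 0" by simp
        qed auto
        then obtain r where "(h \<longlongrightarrow> r) (tr p)"
          using tr_tendsto_U[OF p(2)] by blast
        \<comment> \<open>Since the cutoff \<open>\<phi>\<close> tends to 1 along the trace,
          dividing by it recovers the limit of \<open>g\<close>.\<close>
        then have "((\<lambda>y. h y / \<phi> y) \<longlongrightarrow> r / 1) (tr p)"
          using lim\<phi> by (intro tendsto_divide) auto
        moreover have "\<forall>\<^sub>F y in tr p. h y / \<phi> y = g y"
        proof -
          have "\<forall>\<^sub>F y in tr p. \<phi> y > 0"
            using lim\<phi> by (rule order_tendstoD) simp
          then show ?thesis
            using evW by eventually_elim (auto simp: h_def)
        qed
        ultimately show "\<exists>r. (g \<longlongrightarrow> r) (tr p)"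
          using tendsto_cong by metis
      qed
      then obtain z where "limitin X (\<lambda>y. y) z (tr p)"
        unfolding limitin_subtopology by blast
      then show ?thesis
        using limitin_tr_imp_eq_b[OF pB] limitin_topspace by fast
    qed
    then have "V \<inter> (U - b ` topspace X) = {}" by blast
    moreover have "b x \<in> V" using WV x W by blast
    ultimately show ?thesis
      unfolding K_def using V(1) by (auto simp: in_closure_of)
  qed
  then show ?thesis by blast
qed

definition adm :: "('c \<times> 'c) set set" where
  "adm = {E. E \<subseteq> (topspace B - b ` topspace X) \<times> (topspace B - b ` topspace X) \<and>
     sym E \<and> trans E \<and> Id_on K \<subseteq> E \<and> closedin (prod_topology B B) E}"

lemma closedin_adm_diagonal:
  assumes "closedin (prod_topology B B) E"
  shows "closedin B {p \<in> topspace B. (p, p) \<in> E}"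
proof -
  have "continuous_map B (prod_topology B B) (\<lambda>p. (p, p))"
    by (simp add: continuous_map_pairwise o_def)
  then show ?thesis
    using closedin_continuous_map_preimage assms by blast
qed

text \<open>The condition on \<open>K\<close> comes from realcompactness: at a new point of
  \<open>U\<close> every real function on \<open>T\<close>, restricted to \<open>X\<close>,
  converges along the trace, so the trace has a limit in \<open>T\<close>, necessarily in the
  remainder. The field is closed and so contains the closure \<open>K\<close>.\<close>

lemma lim_rel_adm:
  assumes "(T, e) \<in> RC_ext X"
  shows "lim_rel T e \<in> adm"
proof -
  have ext: "is_extension X T e" and rc: "realcompact T" and C: "compactin T (topspace T - e ` topspace X)"
    using assms by (auto simp: RC_ext_def)
  interpret T: stone_cech_extension X B b T e by unfold_locales fact
  have cl: "closedin (prod_topology B B) (lim_rel T e)"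
    using T.closedin_lim_rel[OF C] .
  have "(p, p) \<in> lim_rel T e" if p: "p \<in> U - b ` topspace X" for p
  proof -
    have pB: "p \<in> topspace B" using p U_subset by blast
    have "\<exists>t. limitin T e t (tr p)"
    proof (rule realcompact_imp_convergent[OF rc tr_nonbot[OF pB]])
      show "\<forall>\<^sub>F x in tr p. e x \<in> topspace T"
        using tr_topspace[OF pB] by (rule eventually_mono) (rule T.e_in_topspace)
      show "\<exists>r. ((\<lambda>x. f (e x)) \<longlongrightarrow> r) (tr p)" if f: "continuous_map T euclideanreal f" for f
        using continuous_map_compose[OF T.continuous_e f] p by (intro tr_tendsto_U) (auto simp: o_def)
    qed
    then obtain t where t: "limitin T e t (tr p)" ..
    have "t \<notin> e ` topspace X"
      using T.limitin_e_imp_eq_b[OF _ pB] t p by blast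
    then show ?thesis
      unfolding lim_rel_def using t pB limitin_topspace[OF t] by blast
  qed
  then have "U - b ` topspace X \<subseteq> {p \<in> topspace B. (p, p) \<in> lim_rel T e}"
    using U_subset by blast
  then have "K \<subseteq> {p \<in> topspace B. (p, p) \<in> lim_rel T e}"
    unfolding K_def by (rule closure_of_minimal) (rule closedin_adm_diagonal[OF cl])
  then have "Id_on K \<subseteq> lim_rel T e" by (auto simp: Id_on_def)
  then show ?thesis
    unfolding adm_def using T.lim_rel_subset T.sym_lim_rel T.trans_lim_rel cl by blast
qed

end

section \<open>Every admissible relation comes from an extension\<close>

context stone_cech_space
begin

text \<open>By density a point of \<open>B\<close> is determined by the traces of its neighbourhoods on \<open>X\<close>; coding a
  class by the traces at a chosen member makes the quotient fit into the carrier type \<open>'a set set\<close>.\<close>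
lemma quotient_function_exists:
  assumes E: "equiv (topspace B) E"
  obtains \<tau> :: "'c \<Rightarrow> 'a set set"
  where "\<And>p q. \<lbrakk>p \<in> topspace B; q \<in> topspace B\<rbrakk> \<Longrightarrow> \<tau> p = \<tau> q \<longleftrightarrow> (p, q) \<in> E"
proof -
  define \<sigma> where "\<sigma> p = {{x \<in> topspace X. b x \<in> V} |V. openin B V \<and> p \<in> V}" for p
  have inj: "\<sigma> p \<noteq> \<sigma> q" if pq: "p \<in> topspace B" "q \<in> topspace B" "p \<noteq> q" for p q
  proof
    assume eq: "\<sigma> p = \<sigma> q"
    obtain V V' where V: "openin B V" "openin B V'" "p \<in> V" "q \<in> V'" "disjnt V V'"
      using Hausdorff_B pq unfolding Hausdorff_space_def by blast
    then have "{x \<in> topspace X. b x \<in> V} \<in> \<sigma> q"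
      using eq unfolding \<sigma>_def by blast
    then obtain V'' where V'': "openin B V''" "q \<in> V''"
      "{x \<in> topspace X. b x \<in> V} = {x \<in> topspace X. b x \<in> V''}"
      unfolding \<sigma>_def by blast
    have "q \<in> B closure_of (b ` topspace X)"
      using pq dense_b by simp
    moreover have "openin B (V' \<inter> V'')" "q \<in> V' \<inter> V''"
      using V V'' by auto
    ultimately obtain x where "x \<in> topspace X" "b x \<in> V'" "b x \<in> V''"
      unfolding in_closure_of by blast
    then show False
      using V'' V(5) by (auto simp: disjnt_iff)
  qed
  \<comment> \<open>The choice depends only on the class of \<open>p\<close>, so
    \<open>\<rho>\<close> is constant on classes.\<close>
  define \<rho> where "\<rho> p = (SOME q. q \<in> E `` {p})" for p
  have \<rho>: "(p, \<rho> p) \<in> E" if "p \<in> topspace B" for p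
  proof -
    have "p \<in> E `` {p}"
      using E that by (rule equiv_class_self)
    then have "\<rho> p \<in> E `` {p}"
      unfolding \<rho>_def by (rule someI)
    then show ?thesis by blast
  qed
  have "\<sigma> (\<rho> p) = \<sigma> (\<rho> q) \<longleftrightarrow> (p, q) \<in> E" if pq: "p \<in> topspace B" "q \<in> topspace B" for p q
  proof
    assume "(p, q) \<in> E"
    then have "E `` {p} = E `` {q}"
      using E by (rule equiv_class_eq[rotated])
    then show "\<sigma> (\<rho> p) = \<sigma> (\<rho> q)"
      by (simp add: \<rho>_def)
  next
    assume eq: "\<sigma> (\<rho> p) = \<sigma> (\<rho> q)"
    have "\<rho> p \<in> topspace B" "\<rho> q \<in> topspace B"
      using \<rho>[OF pq(1)] \<rho>[OF pq(2)] E by (auto dest: equiv_type)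
    then have "\<rho> p = \<rho> q"
      using inj eq by blast
    then show "(p, q) \<in> E"
      using \<rho>[OF pq(1)] \<rho>[OF pq(2)] E by (metis equiv_def symE transE)
  qed
  then show ?thesis
    using that[of "\<lambda>p. \<sigma> (\<rho> p)"] by blast
qed

end

context hewitt_space
begin

text \<open>The extension is the part of the quotient of \<open>B\<close> that lies over
  \<open>X\<close> and over the field \<open>H\<close>. For realcompactness, a filter either
  converges to a point of the compact remainder or is separated from it; in the second case it is a
  filter on \<open>X\<close> with a limit in \<open>U\<close>, which lies over the extension because
  \<open>H\<close> contains \<open>K\<close>.\<close>

lemma adm_realized:
  assumes "E \<in> adm"
  obtains T e where "(T, e) \<in> RC_ext X" "lim_rel T e = E"
proof -
  have Esub: "E \<subseteq> (topspace B - b ` topspace X) \<times> (topspace B - b ` topspace X)"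
    and Esym: "sym E" and Etrans: "trans E" and EK: "Id_on K \<subseteq> E"
    and Ecl: "closedin (prod_topology B B) E"
    using assms by (auto simp: adm_def)
  define H where "H = {p \<in> topspace B. (p, p) \<in> E}"
  have clH: "closedin B H"
    unfolding H_def by (rule closedin_adm_diagonal[OF Ecl])
  have HB: "H \<subseteq> topspace B" and HX: "H \<inter> b ` topspace X = {}" and KH: "K \<subseteq> H"
    using Esub EK closedin_subset[OF closedin_K] by (auto simp: H_def)
  have EH: "p \<in> H" "q \<in> H" if "(p, q) \<in> E" for p q
  proof -
    have "(q, p) \<in> E" using Esym that by (rule symD)
    then have "(p, p) \<in> E" "(q, q) \<in> E"
      using Etrans that by (blast dest: transD)+
    then show "p \<in> H" "q \<in> H" using Esub by (auto simp: H_def)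
  qed
  \<comment> \<open>Adding the full diagonal makes an equivalence on all of \<open>B\<close>; points
    off the field remain single.\<close>
  have "equiv (topspace B) (E \<union> Id_on (topspace B))"
    using Esub Esym Etrans unfolding equiv_def refl_on_def sym_def trans_def by blast
  then obtain \<tau> :: "'c \<Rightarrow> 'a set set" where
    \<tau>0: "\<And>p q. \<lbrakk>p \<in> topspace B; q \<in> topspace B\<rbrakk> \<Longrightarrow> \<tau> p = \<tau> q \<longleftrightarrow> (p, q) \<in> E \<union> Id_on (topspace B)"
    using quotient_function_exists by blast
  have \<tau>: "\<tau> p = \<tau> q \<longleftrightarrow> (p, q) \<in> E \<or> p = q" if "p \<in> topspace B" "q \<in> topspace B" for p q
    using \<tau>0[OF that] that by auto
  have "closedin (prod_topology B B) (E \<union> (\<lambda>p. (p, p)) ` topspace B)"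
    using Ecl Hausdorff_B by (intro closedin_Un) (auto simp: Hausdorff_space_closedin_diagonal)
  moreover have "E \<union> (\<lambda>p. (p, p)) ` topspace B = {(p, q). p \<in> topspace B \<and> q \<in> topspace B \<and> \<tau> p = \<tau> q}"
  proof -
    have "p \<in> topspace B \<and> q \<in> topspace B" if "(p, q) \<in> E" for p q
      using that Esub by blast
    then show ?thesis
      using \<tau> by (intro set_eqI) (simp add: image_iff split_paired_all, metis)
  qed
  ultimately have ker: "closedin (prod_topology B B) {(p, q). p \<in> topspace B \<and> q \<in> topspace B \<and> \<tau> p = \<tau> q}"
    by simp
  obtain Q where Q: "topspace Q = \<tau> ` topspace B" "continuous_map B Q \<tau>" "closed_map B Q \<tau>"
    "compact_space Q" "Hausdorff_space Q"
    by (rule closed_equivalence_quotient[OF compact_B Hausdorff_B ker])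
  \<comment> \<open>Points outside \<open>X\<close> and the field are single points of
    \<open>Q\<close> and are dropped here, so their traces lose their limits.\<close>
  define S where "S = b ` topspace X \<union> H"
  define T where "T = subtopology Q (\<tau> ` S)"
  define e where "e = \<tau> \<circ> b"
  have bB: "b ` topspace X \<subseteq> topspace B" using b_in_topspace by blast
  have SB: "S \<subseteq> topspace B" using bB HB by (auto simp: S_def)
  have topT: "topspace T = \<tau> ` S"
    using Q(1) SB by (auto simp: T_def)
  \<comment> \<open>All three sets are saturated, because \<open>E\<close> relates only points of
    \<open>H\<close>.\<close>
  have sat: "p \<in> A" if pA: "p \<in> topspace B" "\<tau> p \<in> \<tau> ` A" "A = b ` topspace X \<or> A = H \<or> A = S" for p A
  proof -
    obtain a where a: "a \<in> A" "\<tau> p = \<tau> a" using pA(2) by blast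
    have "a \<in> topspace B" using a pA(3) bB HB SB by blast
    then have "(p, a) \<in> E \<or> p = a" using \<tau> pA(1) a by blast
    then show ?thesis
      using EH[of p a] a pA(3) HX by (auto simp: S_def)
  qed
  have UB: "U \<subseteq> S"
    using U_subset_K KH by (auto simp: S_def)
  have crQ: "completely_regular_space Q"
    using Q(4,5) compact_Hausdorff_or_regular_imp_normal_space normal_imp_completely_regular_space by blast
  have crT: "completely_regular_space T" and hT: "Hausdorff_space T"
    using crQ Q(5) by (auto simp: T_def completely_regular_space_subtopology Hausdorff_space_subtopology)
  have "homeomorphic_map (subtopology B (b ` topspace X)) (subtopology Q (\<tau> ` b ` topspace X)) \<tau>"
  proof (rule bijective_closed_imp_homeomorphic_map)
    show "continuous_map (subtopology B (b ` topspace X)) (subtopology Q (\<tau> ` b ` topspace X)) \<tau>"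
      using Q(2) by (auto simp: continuous_map_in_subtopology continuous_map_from_subtopology)
    show "closed_map (subtopology B (b ` topspace X)) (subtopology Q (\<tau> ` b ` topspace X)) \<tau>"
    proof (rule closed_map_restriction[OF Q(3)], intro equalityI subsetI)
      fix p assume "p \<in> {p \<in> topspace B. \<tau> p \<in> \<tau> ` b ` topspace X}"
      then show "p \<in> b ` topspace X" using sat[of p "b ` topspace X"] by simp
    next
      fix p assume "p \<in> b ` topspace X"
      then show "p \<in> {p \<in> topspace B. \<tau> p \<in> \<tau> ` b ` topspace X}" using bB by blast
    qed
    show "\<tau> ` topspace (subtopology B (b ` topspace X)) = topspace (subtopology Q (\<tau> ` b ` topspace X))"
      using Q(1) bB by auto
    have "p = q" if "p \<in> b ` topspace X" "q \<in> b ` topspace X" "\<tau> p = \<tau> q" for p q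
      using that \<tau>[of p q] bB Esub by blast
    then show "inj_on \<tau> (topspace (subtopology B (b ` topspace X)))"
      by (auto simp: inj_on_def)
  qed
  then have "homeomorphic_map X (subtopology Q (\<tau> ` b ` topspace X)) (\<tau> \<circ> b)"
    using embedding_b homeomorphic_map_compose unfolding embedding_map_def by blast
  then have embQ: "embedding_map X Q e"
    unfolding embedding_map_def e_def by (simp add: image_comp)
  have eS: "e ` topspace X \<subseteq> \<tau> ` S" by (auto simp: e_def S_def)
  have embT: "embedding_map X T e"
    unfolding T_def embedding_map_in_subtopology using embQ eS by blast
  have "topspace Q \<subseteq> Q closure_of (e ` topspace X)"
    using continuous_map_image_closure_subset[OF Q(2), of "b ` topspace X"] dense_b Q(1)
    by (simp add: e_def image_comp)
  then have dense: "T closure_of (e ` topspace X) = topspace T"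
    unfolding T_def closure_of_subtopology using eS Q(1) SB by (auto simp: Int_absorb1)
  have ext: "is_extension X T e"
    unfolding is_extension_def using crT hT embT dense by blast
  have rem: "topspace T - e ` topspace X = \<tau> ` H"
  proof -
    have "\<tau> p \<notin> \<tau> ` b ` topspace X" if "p \<in> H" for p
      using sat[of p "b ` topspace X"] that HB HX by blast
    then show ?thesis
      unfolding topT S_def e_def by (auto simp: image_comp)
  qed
  have "compactin Q (\<tau> ` H)"
    using image_compactin[OF _ Q(2)] clH compact_B closedin_compact_space by blast
  then have "compactin T (\<tau> ` H)"
    unfolding T_def compactin_subtopology by (auto simp: S_def)
  then have comp: "compactin T (topspace T - e ` topspace X)"
    unfolding rem .
  have limQ: "limitin Q e (\<tau> p) (tr p)" if "p \<in> topspace B" for p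
    using limitin_compose_continuous_map[OF Q(2) tr_limitin[OF that]] by (simp add: e_def o_def)
  have limT: "limitin T e (\<tau> p) (tr p)" if "p \<in> S" for p
  proof -
    have pB: "p \<in> topspace B" using that SB by blast
    have "\<forall>\<^sub>F x in tr p. e x \<in> \<tau> ` S"
      using tr_topspace[OF pB] by (rule eventually_mono) (use eS in blast)
    then show ?thesis
      unfolding T_def limitin_subtopology using that limQ[OF pB] by blast
  qed
  have limT_eq: "t = \<tau> p" if "p \<in> topspace B" "limitin T e t (tr p)" for p t
  proof -
    have "limitin Q e t (tr p)"
      using that(2) unfolding T_def limitin_subtopology by blast
    then show ?thesis
      using limitin_Hausdorff_unique limQ[OF that(1)] tr_nonbot[OF that(1)] Q(5) by metis
  qed
  have rel: "lim_rel T e = E"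
  proof (intro equalityI subrelI)
    fix p q assume "(p, q) \<in> lim_rel T e"
    then obtain t where t: "p \<in> topspace B" "q \<in> topspace B" "t \<in> \<tau> ` H"
      "limitin T e t (tr p)" "limitin T e t (tr q)"
      unfolding lim_rel_def rem by blast
    then have tt: "t = \<tau> p" "t = \<tau> q"
      using limT_eq by blast+
    have "p \<in> H"
      using t sat[of p H] tt(1) by metis
    moreover have "(p, q) \<in> E \<or> p = q"
      using \<tau>[OF t(1,2)] tt by metis
    ultimately show "(p, q) \<in> E"
      by (auto simp: H_def)
  next
    fix p q assume pq: "(p, q) \<in> E"
    have "p \<in> H" "q \<in> H" using EH[OF pq] by blast+
    moreover have "\<tau> p = \<tau> q" using \<tau> pq Esub by blast
    ultimately have "limitin T e (\<tau> p) (tr p)" "limitin T e (\<tau> p) (tr q)" "\<tau> p \<in> \<tau> ` H"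
      using limT[of p] limT[of q] by (auto simp: S_def)
    then show "(p, q) \<in> lim_rel T e"
      unfolding lim_rel_def rem using pq Esub by blast
  qed
  have "realcompact T"
  proof (rule realcompactI_convergent[OF crT hT])
    fix F assume F: "F \<noteq> bot" "\<forall>\<^sub>F t in F. t \<in> topspace T"
      and conv: "\<And>f. continuous_map T euclideanreal f \<Longrightarrow> \<exists>r. (f \<longlongrightarrow> r) F"
    show "\<exists>z. limitin T (\<lambda>z. z) z F"
    proof (rule compactin_limit_or_separated[OF crT comp F(2)])
      fix h W assume h: "continuous_map T euclideanreal h" "openin T W" "topspace T - e ` topspace X \<subseteq> W"
        "\<And>t. t \<in> W \<Longrightarrow> h t = 0" "\<forall>\<^sub>F t in F. h t = (1::real)"
      obtain m where m: "continuous_map (subtopology T (e ` topspace X)) X m" "\<forall>x\<in>topspace X. m (e x) = x"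
        using embT unfolding embedding_map_def homeomorphic_map_maps homeomorphic_maps_def by blast
      have TW: "topspace T - W \<subseteq> e ` topspace X" using h(3) by blast
      have evW: "\<forall>\<^sub>F t in F. t \<in> topspace T - W"
        using h(5) F(2) by eventually_elim (use h(4) in fastforce)
      have evX: "\<forall>\<^sub>F t in F. m t \<in> topspace X"
        using evW by (rule eventually_mono) (use TW m(2) in auto)
      have conv_m: "\<exists>r. ((\<lambda>t. f (m t)) \<longlongrightarrow> r) F" if f: "continuous_map X euclideanreal f" for f
      proof -
        \<comment> \<open>\<open>f\<close> itself need not extend to \<open>T\<close>. Its product
          with \<open>h\<close>, which vanishes near the remainder, does extend, and eventually
          along \<open>F\<close> the factor is 1.\<close>
        define g where "g = (\<lambda>t. if t \<in> W then 0 else h t * f (m t))"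
        have "continuous_map T euclideanreal g"
          unfolding g_def
        proof (rule continuous_map_cases_alt)
          have "closedin T (topspace T - W)" using h(2) by blast
          moreover have "{t \<in> topspace T. t \<notin> W} = topspace T - W" by blast
          ultimately have eq: "T closure_of {t \<in> topspace T. t \<notin> W} = topspace T - W"
            by (simp add: closure_of_closedin)
          have "continuous_map (subtopology T (e ` topspace X)) euclideanreal (\<lambda>t. f (m t))"
            using continuous_map_compose[OF m(1) f] by (simp add: o_def)
          then have "continuous_map (subtopology T (topspace T - W)) euclideanreal (\<lambda>t. f (m t))"
            using TW continuous_map_from_subtopology_mono by blast
          then show "continuous_map (subtopology T (T closure_of {t \<in> topspace T. t \<notin> W})) euclideanreal (\<lambda>t. h t * f (m t))"
            unfolding eq by (intro continuous_map_real_mult continuous_map_from_subtopology[OF h(1)])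
          fix t assume "t \<in> T frontier_of {t \<in> topspace T. t \<in> W}"
          then have "t \<in> T closure_of {t \<in> topspace T. t \<in> W}"
            by (simp add: frontier_of_def)
          then have "h t = (\<lambda>_. 0) t"
            by (rule forall_in_closure_of_eq[OF _ Hausdorff_space_euclidean h(1)]) (use h(4) in auto)
          then show "0 = h t * f (m t)" by simp
        qed auto
        then have "\<exists>r. (g \<longlongrightarrow> r) F"
          by (rule conv)
        then obtain r where r: "(g \<longlongrightarrow> r) F" ..
        have "\<forall>\<^sub>F t in F. g t = f (m t)"
          using evW h(5) by eventually_elim (auto simp: g_def)
        then have "((\<lambda>t. f (m t)) \<longlongrightarrow> r) F"
          by (rule Lim_transform_eventually[OF r])
        then show ?thesis ..
      qed
      obtain u where u: "u \<in> U" "limitin B (\<lambda>t. b (m t)) u F"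
        by (rule convergent_in_U[OF F(1) evX conv_m])
      have "limitin Q (\<lambda>t. \<tau> (b (m t))) (\<tau> u) F"
        by (rule limitin_compose_continuous_map[OF Q(2) u(2)])
      moreover have "\<forall>\<^sub>F t in F. \<tau> (b (m t)) = t"
        using evW by (rule eventually_mono) (use TW m(2) in \<open>auto simp: e_def\<close>)
      ultimately have "limitin Q (\<lambda>t. t) (\<tau> u) F"
        using limitin_transform_eventually by fast
      moreover have "\<forall>\<^sub>F t in F. t \<in> \<tau> ` S"
        using F(2) topT by simp
      ultimately have "limitin T (\<lambda>t. t) (\<tau> u) F"
        unfolding T_def limitin_subtopology using u(1) UB by blast
      then show ?thesis ..
    next
      show "\<exists>r. (f \<longlongrightarrow> r) F" if "continuous_map T euclideanreal f" for f
        using conv that .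
    qed blast
  qed
  then have "(T, e) \<in> RC_ext X"
    using ext comp by (simp add: RC_ext_def)
  then show ?thesis
    using that rel by blast
qed

end

section \<open>Recovering a space from its closed equivalence relations\<close>

definition closed_equivs :: "'a topology \<Rightarrow> ('a \<times> 'a) set set" where
  "closed_equivs S = {E. equiv (topspace S) E \<and> closedin (prod_topology S S) E}"

text \<open>Disjointness of the blocks is what gives transitivity. Two blocks are needed to show
  that disjoint pairs do not generate a third one.\<close>

lemma closed_equivs_block:
  assumes "Hausdorff_space S" "closedin S F" "closedin S G" "F \<inter> G = {}"
  shows "Id_on (topspace S) \<union> F \<times> F \<union> G \<times> G \<in> closed_equivs S" (is "?E \<in> _")
proof -
  have FG: "F \<subseteq> topspace S" "G \<subseteq> topspace S"
    using assms closedin_subset by blast+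
  have "Id_on (topspace S) = (\<lambda>x. (x, x)) ` topspace S" by auto
  then have "closedin (prod_topology S S) ?E"
    using assms by (auto intro!: closedin_Un simp: Hausdorff_space_closedin_diagonal closedin_prod_Times_iff)
  moreover have "equiv (topspace S) ?E"
    using FG assms(4) unfolding equiv_def refl_on_def sym_def trans_def by blast
  ultimately show ?thesis by (simp add: closed_equivs_def)
qed

lemma closed_equivs_set:
  assumes "Hausdorff_space S" "closedin S F"
  shows "Id_on (topspace S) \<union> F \<times> F \<in> closed_equivs S"
  using closed_equivs_block[OF assms, of "{}"] by simp

lemma Id_on_subset_closed_equivs: "E \<in> closed_equivs S \<Longrightarrow> Id_on (topspace S) \<subseteq> E"
  by (auto simp: closed_equivs_def equiv_def refl_on_def)

lemma closed_equivs_subset: "E \<in> closed_equivs S \<Longrightarrow> E \<subseteq> topspace S \<times> topspace S"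
  by (auto simp: closed_equivs_def dest: equiv_type)

lemma closed_equivs_contains_pair_iff:
  assumes "E \<in> closed_equivs S" "a \<in> topspace S" "b \<in> topspace S"
  shows "Id_on (topspace S) \<union> {a, b} \<times> {a, b} \<subseteq> E \<longleftrightarrow> (a, b) \<in> E"
proof
  assume "(a, b) \<in> E"
  moreover from this have "(b, a) \<in> E"
    using assms(1) by (auto simp: closed_equivs_def equiv_def dest: symD)
  moreover have "(a, a) \<in> E" "(b, b) \<in> E"
    using assms Id_on_subset_closed_equivs by blast+
  ultimately show "Id_on (topspace S) \<union> {a, b} \<times> {a, b} \<subseteq> E"
    using Id_on_subset_closed_equivs[OF assms(1)] by blast
qed blast

text \<open>A nonempty closed set \<open>F\<close> is the class of its point \<open>x\<close> in the
  relation collapsing \<open>F\<close>. Its image is the class of \<open>f x\<close> in the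
  transported relation, a section of a closed set.\<close>

lemma closed_map_of_closed_equivs:
  assumes S: "Hausdorff_space S" and bij: "bij_betw f (topspace S) (topspace S')"
    and E: "\<And>E. E \<in> closed_equivs S \<Longrightarrow>
      \<exists>E'\<in>closed_equivs S'. \<forall>a\<in>topspace S. \<forall>b\<in>topspace S. (f a, f b) \<in> E' \<longleftrightarrow> (a, b) \<in> E"
  shows "closed_map S S' f"
  unfolding closed_map_def
proof (intro allI impI)
  fix F assume F: "closedin S F"
  show "closedin S' (f ` F)"
  proof (cases "F = {}")
    case False
    then obtain x where x: "x \<in> F" by blast
    have FS: "F \<subseteq> topspace S" using F by (rule closedin_subset)
    obtain E' where E': "E' \<in> closed_equivs S'"
      "\<forall>a\<in>topspace S. \<forall>b\<in>topspace S. (f a, f b) \<in> E' \<longleftrightarrow> (a, b) \<in> Id_on (topspace S) \<union> F \<times> F"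
      using E[OF closed_equivs_set[OF S F]] by blast
    have fx: "f x \<in> topspace S'" using x FS bij by (auto simp: bij_betw_def)
    have "continuous_map S' (prod_topology S' S') (\<lambda>u. (f x, u))"
      using fx by (simp add: continuous_map_pairwise o_def)
    then have "closedin S' {u \<in> topspace S'. (f x, u) \<in> E'}"
      using E'(1) closedin_continuous_map_preimage unfolding closed_equivs_def by blast
    moreover have "{u \<in> topspace S'. (f x, u) \<in> E'} = f ` F"
    proof -
      have "u \<in> f ` F" if u: "u \<in> topspace S'" "(f x, u) \<in> E'" for u
      proof -
        obtain y where y: "y \<in> topspace S" "u = f y"
          using u(1) bij by (auto simp: bij_betw_def)
        have "x \<in> topspace S" using x FS by blast
        then have "(x, y) \<in> Id_on (topspace S) \<union> F \<times> F"
          using E'(2) u(2) y by metis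
        then have "y \<in> F" using x by auto
        then show ?thesis using y by simp
      qed
      moreover have "f y \<in> topspace S' \<and> (f x, f y) \<in> E'" if "y \<in> F" for y
      proof -
        have "x \<in> topspace S" "y \<in> topspace S" "(x, y) \<in> Id_on (topspace S) \<union> F \<times> F"
          using that x FS by auto
        then show ?thesis using E'(2) bij by (metis bij_betw_apply)
      qed
      ultimately show ?thesis by blast
    qed
    ultimately show ?thesis by simp
  qed simp
qed

locale closed_equivs_iso =
  fixes S :: "'a topology" and S' :: "'b topology" and \<psi>
  assumes S: "Hausdorff_space S" and S': "Hausdorff_space S'"
    and bij: "bij_betw \<psi> (closed_equivs S) (closed_equivs S')"
    and mono: "\<And>E E'. \<lbrakk>E \<in> closed_equivs S; E' \<in> closed_equivs S\<rbrakk> \<Longrightarrow> \<psi> E \<subseteq> \<psi> E' \<longleftrightarrow> E \<subseteq> E'"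
begin

definition R :: "'a set \<Rightarrow> ('a \<times> 'a) set" where "R F = Id_on (topspace S) \<union> F \<times> F"
definition R' :: "'b set \<Rightarrow> ('b \<times> 'b) set" where "R' F = Id_on (topspace S') \<union> F \<times> F"

lemma \<psi>_in: "E \<in> closed_equivs S \<Longrightarrow> \<psi> E \<in> closed_equivs S'"
  using bij by (auto simp: bij_betw_def)

lemma \<psi>_surj:
  assumes "E' \<in> closed_equivs S'"
  obtains E where "E \<in> closed_equivs S" "\<psi> E = E'"
proof -
  have "E' \<in> \<psi> ` closed_equivs S"
    using assms bij by (simp add: bij_betw_def)
  then show ?thesis
    using that by blast
qed

lemma R_in: "\<lbrakk>finite F; F \<subseteq> topspace S\<rbrakk> \<Longrightarrow> R F \<in> closed_equivs S"
  unfolding R_def using S by (intro closed_equivs_set closedin_Hausdorff_finite) auto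

lemma R'_in: "\<lbrakk>finite F; F \<subseteq> topspace S'\<rbrakk> \<Longrightarrow> R' F \<in> closed_equivs S'"
  unfolding R'_def using S' by (intro closed_equivs_set closedin_Hausdorff_finite) auto

lemma R_pair_subset_iff:
  "\<lbrakk>E \<in> closed_equivs S; a \<in> topspace S; b \<in> topspace S\<rbrakk> \<Longrightarrow> R {a, b} \<subseteq> E \<longleftrightarrow> (a, b) \<in> E"
  unfolding R_def by (rule closed_equivs_contains_pair_iff)

lemma R'_pair_subset_iff:
  "\<lbrakk>E \<in> closed_equivs S'; u \<in> topspace S'; v \<in> topspace S'\<rbrakk> \<Longrightarrow> R' {u, v} \<subseteq> E \<longleftrightarrow> (u, v) \<in> E"
  unfolding R'_def by (rule closed_equivs_contains_pair_iff)

lemma nontrivial_pair: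
  assumes "E \<in> closed_equivs S'" "\<not> E \<subseteq> Id_on (topspace S')"
  obtains u v where "u \<in> topspace S'" "v \<in> topspace S'" "u \<noteq> v" "(u, v) \<in> E"
proof -
  obtain u v where uv: "(u, v) \<in> E" "(u, v) \<notin> Id_on (topspace S')"
    using assms(2) by (meson subrelI)
  then have "u \<in> topspace S'" "v \<in> topspace S'"
    using closed_equivs_subset[OF assms(1)] by auto
  moreover from this have "u \<noteq> v"
    using uv(2) by blast
  ultimately show ?thesis
    using that uv(1) by blast
qed

text \<open>The diagonal is the least closed equivalence relation, hence preserved by
  \<open>\<psi>\<close>.\<close>

lemma \<psi>_trivial_iff:
  assumes E: "E \<in> closed_equivs S"
  shows "\<psi> E \<subseteq> Id_on (topspace S') \<longleftrightarrow> E \<subseteq> Id_on (topspace S)"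
proof -
  have I: "Id_on (topspace S) \<in> closed_equivs S" and I': "Id_on (topspace S') \<in> closed_equivs S'"
    using R_in[of "{}"] R'_in[of "{}"] by (auto simp: R_def R'_def)
  obtain D where D: "D \<in> closed_equivs S" "\<psi> D = Id_on (topspace S')"
    using \<psi>_surj[OF I'] .
  have "\<psi> (Id_on (topspace S)) \<subseteq> \<psi> D"
    using mono[OF I D(1)] Id_on_subset_closed_equivs[OF D(1)] by blast
  then have "\<psi> (Id_on (topspace S)) = Id_on (topspace S')"
    using D(2) Id_on_subset_closed_equivs[OF \<psi>_in[OF I]] by blast
  then show ?thesis
    using mono[OF E I] by simp
qed

text \<open>Pair relations are the atoms. The image contains some \<open>R' {u, v}\<close>, whose
  preimage is a nontrivial relation below \<open>R {a, b}\<close> and thus equal to it.\<close>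

lemma pair_image:
  assumes ab: "a \<in> topspace S" "b \<in> topspace S" "a \<noteq> b"
  obtains u v where "u \<in> topspace S'" "v \<in> topspace S'" "u \<noteq> v" "\<psi> (R {a, b}) = R' {u, v}"
proof -
  have Rab: "R {a, b} \<in> closed_equivs S" using ab by (intro R_in) auto
  have "\<not> R {a, b} \<subseteq> Id_on (topspace S)" using ab by (auto simp: R_def)
  then obtain u v where uv: "u \<in> topspace S'" "v \<in> topspace S'" "u \<noteq> v" "(u, v) \<in> \<psi> (R {a, b})"
    using nontrivial_pair \<psi>_in[OF Rab] \<psi>_trivial_iff[OF Rab] by metis
  have R'uv: "R' {u, v} \<in> closed_equivs S'" using uv by (intro R'_in) auto
  obtain E where E: "E \<in> closed_equivs S" "\<psi> E = R' {u, v}"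
    using \<psi>_surj[OF R'uv] .
  have "\<psi> E \<subseteq> \<psi> (R {a, b})"
    using R'_pair_subset_iff[OF \<psi>_in[OF Rab]] uv E by blast
  then have "E \<subseteq> R {a, b}"
    using mono E Rab by blast
  moreover have "\<not> E \<subseteq> Id_on (topspace S)"
    using \<psi>_trivial_iff[OF E(1)] E(2) uv by (auto simp: R'_def)
  then obtain x y where xy: "(x, y) \<in> E" "(x, y) \<notin> Id_on (topspace S)"
    by (meson subrelI)
  ultimately have "(x, y) \<in> {a, b} \<times> {a, b}"
    unfolding R_def by blast
  then have "(a, b) \<in> E \<or> (b, a) \<in> E"
    using xy ab by auto
  then have "(a, b) \<in> E"
    using E(1) unfolding closed_equivs_def equiv_def sym_def by blast
  then have "R {a, b} \<subseteq> E"
    using R_pair_subset_iff[OF E(1)] ab by blast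
  then have "E = R {a, b}"
    using \<open>E \<subseteq> R {a, b}\<close> by blast
  then show ?thesis
    using that uv E(2) by blast
qed

lemma pair_preimage:
  assumes uv: "u \<in> topspace S'" "v \<in> topspace S'" "u \<noteq> v"
  obtains a b where "a \<in> topspace S" "b \<in> topspace S" "a \<noteq> b" "\<psi> (R {a, b}) = R' {u, v}"
proof -
  have R'uv: "R' {u, v} \<in> closed_equivs S'" using uv by (intro R'_in) auto
  obtain E where E: "E \<in> closed_equivs S" "\<psi> E = R' {u, v}"
    using \<psi>_surj[OF R'uv] .
  have "\<not> E \<subseteq> Id_on (topspace S)"
    using \<psi>_trivial_iff[OF E(1)] E(2) uv by (auto simp: R'_def)
  then obtain a b where ab: "a \<in> topspace S" "b \<in> topspace S" "a \<noteq> b" "(a, b) \<in> E"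
    using closed_equivs_subset[OF E(1)] by (auto simp: Id_on_def)
  have Rab: "R {a, b} \<in> closed_equivs S" using ab by (intro R_in) auto
  have "R {a, b} \<subseteq> E"
    using R_pair_subset_iff[OF E(1)] ab by blast
  then have sub: "\<psi> (R {a, b}) \<subseteq> R' {u, v}"
    using mono[OF Rab E(1)] E(2) by simp
  obtain x y where xy: "x \<in> topspace S'" "y \<in> topspace S'" "x \<noteq> y" "\<psi> (R {a, b}) = R' {x, y}"
    using pair_image[OF ab(1-3)] .
  have "{x, y} = {u, v}"
    using sub xy by (auto simp: R'_def)
  then show ?thesis
    using that ab xy by metis
qed

lemma R'_pair_inject:
  assumes "R' {u, v} = R' {x, y}" "u \<noteq> v"
  shows "{u, v} = {x, y}"
proof -
  have "(u, v) \<in> R' {x, y}" using assms by (auto simp: R'_def)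
  then show ?thesis using assms(2) by (auto simp: R'_def)
qed

lemma R_pair_inject:
  assumes "R {a, b} = R {c, d}" "a \<noteq> b"
  shows "{a, b} = {c, d}"
proof -
  have "(a, b) \<in> R {c, d}" using assms by (auto simp: R_def)
  then show ?thesis using assms(2) by (auto simp: R_def)
qed

lemma \<psi>_pair_inject:
  assumes "{a, b, c, d} \<subseteq> topspace S" "a \<noteq> b" "\<psi> (R {a, b}) = \<psi> (R {c, d})"
  shows "{a, b} = {c, d}"
proof -
  have "R {a, b} \<in> closed_equivs S" "R {c, d} \<in> closed_equivs S"
    using assms(1) by (auto intro!: R_in)
  then have "R {a, b} = R {c, d}"
    using bij assms(3) by (auto simp: bij_betw_def inj_on_def)
  then show ?thesis using R_pair_inject assms(2) by blast
qed

text \<open>Transitivity puts \<open>R {b, c}\<close> below every upper bound of the other two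
  relations, and \<open>\<psi>\<close> preserves this. Disjoint image pairs would have an upper
  bound with two separate blocks and no room for a third pair, so they share a point
  \<open>u\<close>; collapsing \<open>{u, v, w}\<close> then leaves only \<open>{v, w}\<close> for
  the third.\<close>

lemma triangle_image:
  assumes abc: "a \<in> topspace S" "b \<in> topspace S" "c \<in> topspace S" "a \<noteq> b" "a \<noteq> c" "b \<noteq> c"
  obtains u v w where "u \<in> topspace S'" "v \<in> topspace S'" "w \<in> topspace S'" "u \<noteq> v" "u \<noteq> w" "v \<noteq> w"
    "\<psi> (R {a, b}) = R' {u, v}" "\<psi> (R {a, c}) = R' {u, w}" "\<psi> (R {b, c}) = R' {v, w}"
proof -
  obtain p q where pq: "p \<in> topspace S'" "q \<in> topspace S'" "p \<noteq> q" "\<psi> (R {a, b}) = R' {p, q}"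
    using pair_image[OF abc(1,2,4)] .
  obtain r s where rs: "r \<in> topspace S'" "s \<in> topspace S'" "r \<noteq> s" "\<psi> (R {a, c}) = R' {r, s}"
    using pair_image[OF abc(1,3,5)] .
  obtain t t' where tt: "t \<in> topspace S'" "t' \<in> topspace S'" "t \<noteq> t'" "\<psi> (R {b, c}) = R' {t, t'}"
    using pair_image[OF abc(2,3,6)] .
  have in_S: "R {a, b} \<in> closed_equivs S" "R {a, c} \<in> closed_equivs S" "R {b, c} \<in> closed_equivs S"
    using abc by (auto intro!: R_in)
  have n1: "{p, q} \<noteq> {r, s}"
    using \<psi>_pair_inject[of a b a c] abc pq rs by (metis doubleton_eq_iff insert_subset empty_subsetI)
  have n2: "{t, t'} \<noteq> {p, q}"
    using \<psi>_pair_inject[of a b b c] abc pq tt by (metis doubleton_eq_iff insert_subset empty_subsetI)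
  have n3: "{t, t'} \<noteq> {r, s}"
    using \<psi>_pair_inject[of a c b c] abc rs tt by (metis doubleton_eq_iff insert_subset empty_subsetI)
  have join: "(t, t') \<in> E'" if E': "E' \<in> closed_equivs S'" "(p, q) \<in> E'" "(r, s) \<in> E'" for E'
  proof -
    obtain E where E: "E \<in> closed_equivs S" "\<psi> E = E'"
      using \<psi>_surj[OF E'(1)] .
    have "\<psi> (R {a, b}) \<subseteq> \<psi> E" "\<psi> (R {a, c}) \<subseteq> \<psi> E"
      using R'_pair_subset_iff[OF E'(1)] pq rs E E' by auto
    then have "R {a, b} \<subseteq> E" "R {a, c} \<subseteq> E"
      using mono E(1) in_S by blast+
    then have "(a, b) \<in> E" "(a, c) \<in> E"
      by (auto simp: R_def)
    then have "(b, c) \<in> E"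
      using E(1) unfolding closed_equivs_def equiv_def sym_def trans_def by blast
    then have "R {b, c} \<subseteq> E"
      using R_pair_subset_iff[OF E(1)] abc by blast
    then have "\<psi> (R {b, c}) \<subseteq> E'"
      using mono[OF in_S(3) E(1)] E(2) by blast
    then show ?thesis
      using R'_pair_subset_iff[OF E'(1)] tt by metis
  qed
  have "{p, q} \<inter> {r, s} \<noteq> {}"
  proof
    assume disj: "{p, q} \<inter> {r, s} = {}"
    have "Id_on (topspace S') \<union> {p, q} \<times> {p, q} \<union> {r, s} \<times> {r, s} \<in> closed_equivs S'"
      using pq rs disj S' by (intro closed_equivs_block closedin_Hausdorff_finite) auto
    from join[OF this] show False
      using tt(3) n2 n3 by auto
  qed
  then obtain u v w where uvw: "{p, q} = {u, v}" "{r, s} = {u, w}"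
    by blast
  then have uv: "u \<noteq> v" "u \<noteq> w" "v \<noteq> w" "{u, v, w} \<subseteq> topspace S'"
    using pq rs n1 by (auto simp: doubleton_eq_iff)
  have "R' {u, v, w} \<in> closed_equivs S'"
    using uv by (intro R'_in) auto
  from join[OF this] have "{t, t'} \<subseteq> {u, v, w}"
    using uvw tt(3) by (auto simp: R'_def doubleton_eq_iff)
  then have "{t, t'} = {v, w}"
    using n2 n3 uvw tt(3) by auto
  then show ?thesis
    using that[of u v w] uv uvw pq(4) rs(4) tt(4) by auto
qed

text \<open>\<open>f a\<close> is the point common to the images of all pairs through
  \<open>a\<close>. Two such pairs are needed to determine it, so spaces with fewer than three
  points are treated separately.\<close>

lemma point_bijection:
  assumes ne: "topspace S \<noteq> {}" "topspace S' \<noteq> {}"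
  obtains f where "bij_betw f (topspace S) (topspace S')"
    "\<forall>a\<in>topspace S. \<forall>b\<in>topspace S. a \<noteq> b \<longrightarrow> \<psi> (R {a, b}) = R' {f a, f b}"
proof (cases "\<exists>a b c. a \<in> topspace S \<and> b \<in> topspace S \<and> c \<in> topspace S \<and> a \<noteq> b \<and> a \<noteq> c \<and> b \<noteq> c")
  case True
  then have third: "\<exists>c\<in>topspace S. c \<noteq> a \<and> c \<noteq> b" for a b
    by metis
  have "\<exists>u. \<forall>b\<in>topspace S. b \<noteq> a \<longrightarrow> (\<exists>v\<in>topspace S'. u \<in> topspace S' \<and> u \<noteq> v \<and> \<psi> (R {a, b}) = R' {u, v})"
    if a: "a \<in> topspace S" for a
  proof -
    obtain b where b: "b \<in> topspace S" "b \<noteq> a" using third by blast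
    obtain c where c: "c \<in> topspace S" "c \<noteq> a" "c \<noteq> b" using third by blast
    obtain u v w where uvw: "u \<in> topspace S'" "v \<in> topspace S'" "w \<in> topspace S'" "u \<noteq> v" "u \<noteq> w" "v \<noteq> w"
      "\<psi> (R {a, b}) = R' {u, v}" "\<psi> (R {a, c}) = R' {u, w}" "\<psi> (R {b, c}) = R' {v, w}"
      using triangle_image[OF a b(1) c(1)] b c by metis
    have "\<exists>x\<in>topspace S'. u \<in> topspace S' \<and> u \<noteq> x \<and> \<psi> (R {a, d}) = R' {u, x}" if d: "d \<in> topspace S" "d \<noteq> a" for d
    proof (cases "d = b \<or> d = c")
      case True
      then show ?thesis using uvw by blast
    next
      case False
      obtain x y z where xyz: "x \<in> topspace S'" "y \<in> topspace S'" "z \<in> topspace S'" "x \<noteq> y" "x \<noteq> z" "y \<noteq> z"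
        "\<psi> (R {a, b}) = R' {x, y}" "\<psi> (R {a, d}) = R' {x, z}" "\<psi> (R {b, d}) = R' {y, z}"
        using triangle_image[OF a b(1) d(1)] b d False by metis
      obtain x' y' z' where xyz': "x' \<noteq> y'" "x' \<noteq> z'" "y' \<noteq> z'"
        "\<psi> (R {a, c}) = R' {x', y'}" "\<psi> (R {a, d}) = R' {x', z'}"
        using triangle_image[OF a c(1) d(1)] c d False by metis
      have e1: "{x, y} = {u, v}" using R'_pair_inject[of x y u v] xyz uvw by metis
      have e2: "{x', y'} = {u, w}" using R'_pair_inject[of x' y' u w] xyz' uvw by metis
      have e3: "{x, z} = {x', z'}" using R'_pair_inject[of x z x' z'] xyz xyz' by metis
      \<comment> \<open>Otherwise the triangles on \<open>a, b, d\<close> and \<open>a, c, d\<close>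
        force the image of \<open>{a, d}\<close> to be \<open>{v, w}\<close>, which is already the
        image of \<open>{b, c}\<close>.\<close>
      have "u \<in> {x, z}"
      proof (rule ccontr)
        assume "u \<notin> {x, z}"
        then have "x = v" "x' = w"
          using e1 e2 e3 by (auto simp: doubleton_eq_iff)
        then have "{x, z} = {v, w}"
          using e3 uvw(6) by (auto simp: doubleton_eq_iff)
        then have "\<psi> (R {a, d}) = \<psi> (R {b, c})"
          using xyz(8) uvw(9) by simp
        then have "{a, d} = {b, c}"
          using \<psi>_pair_inject[of a d b c] a b c d by auto
        then show False using b c by (auto simp: doubleton_eq_iff)
      qed
      then show ?thesis
        using xyz by (metis insert_iff insert_commute singletonD)
    qed
    then show ?thesis by blast
  qed
  then obtain f where f: "\<And>a b. \<lbrakk>a \<in> topspace S; b \<in> topspace S; b \<noteq> a\<rbrakk> \<Longrightarrow>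
      \<exists>v\<in>topspace S'. f a \<in> topspace S' \<and> f a \<noteq> v \<and> \<psi> (R {a, b}) = R' {f a, v}"
    by metis
  have fp: "f a \<in> {u, v}" if pr: "a \<in> topspace S" "b \<in> topspace S" "b \<noteq> a" "\<psi> (R {a, b}) = R' {u, v}" for a b u v
  proof -
    obtain x where x: "f a \<noteq> x" "\<psi> (R {a, b}) = R' {f a, x}"
      using f[OF pr(1-3)] by blast
    then have "R' {f a, x} = R' {u, v}"
      using pr(4) by simp
    then have "{f a, x} = {u, v}"
      using x(1) by (rule R'_pair_inject)
    then show ?thesis by blast
  qed
  have main: "f a \<noteq> f b \<and> \<psi> (R {a, b}) = R' {f a, f b}" if ab: "a \<in> topspace S" "b \<in> topspace S" "a \<noteq> b" for a b
  proof -
    obtain c where c: "c \<in> topspace S" "c \<noteq> a" "c \<noteq> b" using third by blast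
    obtain u v w where uvw: "u \<noteq> v" "u \<noteq> w" "v \<noteq> w"
      "\<psi> (R {a, b}) = R' {u, v}" "\<psi> (R {a, c}) = R' {u, w}" "\<psi> (R {b, c}) = R' {v, w}"
      using triangle_image[OF ab(1,2) c(1)] ab c by metis
    have 1: "f a \<in> {u, v}" by (rule fp[OF ab(1,2) _ uvw(4)]) (use ab in simp)
    have 2: "f a \<in> {u, w}" by (rule fp[OF ab(1) c(1,2) uvw(5)])
    have 3: "f b \<in> {u, v}" by (rule fp[OF ab(2,1,3)]) (use uvw(4) in \<open>simp add: insert_commute\<close>)
    have 4: "f b \<in> {v, w}" by (rule fp[OF ab(2) c(1,3) uvw(6)])
    have "f a = u" "f b = v" using 1 2 3 4 uvw(1-3) by auto
    then show ?thesis using uvw by blast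
  qed
  have fS: "f a \<in> topspace S'" if "a \<in> topspace S" for a
    using f[OF that] third[of a a] by blast
  have "u \<in> f ` topspace S" if u: "u \<in> topspace S'" for u
  proof -
    obtain a b where "a \<in> topspace S" "b \<in> topspace S" "a \<noteq> b" using True by blast
    then have "\<exists>v\<in>topspace S'. v \<noteq> u" using main fS by metis
    then obtain v where v: "v \<in> topspace S'" "u \<noteq> v" by blast
    obtain c d where cd: "c \<in> topspace S" "d \<in> topspace S" "c \<noteq> d" "\<psi> (R {c, d}) = R' {u, v}"
      using pair_preimage[OF u v] .
    then have "{u, v} = {f c, f d}"
      using main[of c d] R'_pair_inject[of u v "f c" "f d"] v(2) by metis
    then show ?thesis using cd by blast
  qed
  then have "bij_betw f (topspace S) (topspace S')"
    using main fS by (auto simp: bij_betw_def inj_on_def)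
  then show ?thesis using that main by blast
next
  case False
  show ?thesis
  proof (cases "\<exists>a b. a \<in> topspace S \<and> b \<in> topspace S \<and> a \<noteq> b")
    case True
    then obtain a b where ab: "a \<in> topspace S" "b \<in> topspace S" "a \<noteq> b" by blast
    then have Sab: "topspace S = {a, b}" using False by blast
    obtain u v where uv: "u \<in> topspace S'" "v \<in> topspace S'" "u \<noteq> v" "\<psi> (R {a, b}) = R' {u, v}"
      using pair_image[OF ab] .
    have "w \<in> {u, v}" if w: "w \<in> topspace S'" for w
    proof (rule ccontr)
      assume wn: "w \<notin> {u, v}"
      then have "u \<noteq> w" by blast
      obtain c d where cd: "c \<in> topspace S" "d \<in> topspace S" "c \<noteq> d" "\<psi> (R {c, d}) = R' {u, w}"
        using pair_preimage[OF uv(1) w \<open>u \<noteq> w\<close>] .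
      then have "{c, d} = {a, b}" using Sab by auto
      then have "{u, v} = {u, w}"
        using cd(4) uv R'_pair_inject[of u v u w] by metis
      then show False using wn by blast
    qed
    then have S'uv: "topspace S' = {u, v}" using uv by blast
    \<comment> \<open>With two points either bijection works, since \<open>R'\<close> depends only
      on the unordered pair.\<close>
    define f where "f x = (if x = a then u else v)" for x
    have fab: "f a = u" "f b = v" using ab by (auto simp: f_def)
    have "bij_betw f (topspace S) (topspace S')"
      unfolding Sab S'uv bij_betw_def using ab uv by (auto simp: f_def)
    moreover have "\<psi> (R {c, d}) = R' {f c, f d}" if "c \<in> topspace S" "d \<in> topspace S" "c \<noteq> d" for c d
      using that uv fab unfolding Sab by (auto simp: insert_commute)
    ultimately show ?thesis using that by blast
  next
    case single: False
    obtain a where a: "topspace S = {a}" using ne(1) single by blast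
    obtain u where u: "u \<in> topspace S'" using ne(2) by blast
    have "v = u" if v: "v \<in> topspace S'" for v
    proof (rule ccontr)
      assume "v \<noteq> u"
      from pair_preimage[OF v u this] show False using single by metis
    qed
    then have "topspace S' = {u}" using u by blast
    then have "bij_betw (\<lambda>_. u) (topspace S) (topspace S')"
      by (simp add: a bij_betw_def)
    moreover have "\<psi> (R {c, d}) = R' {u, u}" if "c \<in> topspace S" "d \<in> topspace S" "c \<noteq> d" for c d
      using that unfolding a by simp
    ultimately show ?thesis using that[of "\<lambda>_. u"] by blast
  qed
qed

theorem homeomorphic:
  assumes "topspace S \<noteq> {}" "topspace S' \<noteq> {}"
  shows "S homeomorphic_space S'"
proof -
  obtain f where f: "bij_betw f (topspace S) (topspace S')"
    "\<forall>a\<in>topspace S. \<forall>b\<in>topspace S. a \<noteq> b \<longrightarrow> \<psi> (R {a, b}) = R' {f a, f b}"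
    using point_bijection[OF assms] .
  have fS: "f a \<in> topspace S'" if "a \<in> topspace S" for a
    using f(1) that by (auto simp: bij_betw_def)
  \<comment> \<open>Membership of a pair is an order statement, namely that its atom lies below the
    relation.\<close>
  have key: "(f a, f b) \<in> \<psi> E \<longleftrightarrow> (a, b) \<in> E"
    if E: "E \<in> closed_equivs S" and ab: "a \<in> topspace S" "b \<in> topspace S" for E a b
  proof (cases "a = b")
    case True
    then show ?thesis
      using Id_on_subset_closed_equivs[OF E] Id_on_subset_closed_equivs[OF \<psi>_in[OF E]] ab fS by blast
  next
    case False
    have "R {a, b} \<in> closed_equivs S" using ab by (intro R_in) auto
    then have "(a, b) \<in> E \<longleftrightarrow> \<psi> (R {a, b}) \<subseteq> \<psi> E"
      using mono E R_pair_subset_iff[OF E ab] by blast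
    then show ?thesis
      using f(2) ab False R'_pair_subset_iff[OF \<psi>_in[OF E] fS[OF ab(1)] fS[OF ab(2)]] by simp
  qed
  have "closed_map S S' f"
    by (rule closed_map_of_closed_equivs[OF S f(1)]) (use key \<psi>_in in blast)
  moreover have "closed_map S' S (inv_into (topspace S) f)" (is "closed_map S' S ?g")
  proof (rule closed_map_of_closed_equivs[OF S'])
    show "bij_betw ?g (topspace S') (topspace S)"
      using f(1) by (rule bij_betw_inv_into)
    fix E' assume "E' \<in> closed_equivs S'"
    then obtain E where E: "E \<in> closed_equivs S" "\<psi> E = E'"
      by (rule \<psi>_surj)
    have "(?g u, ?g v) \<in> E \<longleftrightarrow> (u, v) \<in> E'" if "u \<in> topspace S'" "v \<in> topspace S'" for u v
    proof -
      have "?g u \<in> topspace S" "?g v \<in> topspace S" "f (?g u) = u" "f (?g v) = v"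
        using that f(1) by (auto simp: bij_betw_def inv_into_into f_inv_into_f)
      then show ?thesis using key[OF E(1), of "?g u" "?g v"] E(2) by simp
    qed
    then show "\<exists>E\<in>closed_equivs S. \<forall>u\<in>topspace S'. \<forall>v\<in>topspace S'. (?g u, ?g v) \<in> E \<longleftrightarrow> (u, v) \<in> E'"
      using E(1) by blast
  qed
  moreover have "continuous_map S S' f" if "closed_map S' S ?g"
    unfolding continuous_map_closedin
  proof (intro conjI ballI allI impI)
    show "f \<in> topspace S \<rightarrow> topspace S'" using fS by blast
    fix C assume C: "closedin S' C"
    then have "closedin S (?g ` C)" using that unfolding closed_map_def by blast
    moreover have "?g ` C = {x \<in> topspace S. f x \<in> C}"
    proof (intro equalityI subsetI)
      fix x assume "x \<in> ?g ` C"
      then obtain u where "u \<in> C" "x = ?g u" by blast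
      moreover have "u \<in> f ` topspace S"
        using \<open>u \<in> C\<close> closedin_subset[OF C] f(1) by (auto simp: bij_betw_def)
      ultimately show "x \<in> {x \<in> topspace S. f x \<in> C}"
        by (simp add: inv_into_into f_inv_into_f)
    next
      fix x assume "x \<in> {x \<in> topspace S. f x \<in> C}"
      moreover from this have "?g (f x) = x"
        using f(1) by (simp add: bij_betw_def)
      ultimately show "x \<in> ?g ` C"
        by (metis (mono_tags, lifting) image_eqI mem_Collect_eq)
    qed
    ultimately show "closedin S {x \<in> topspace S. f x \<in> C}" by simp
  qed
  ultimately have "homeomorphic_map S S' f"
    using f(1) by (intro bijective_closed_imp_homeomorphic_map) (auto simp: bij_betw_def)
  then show ?thesis
    using homeomorphic_space by blast
qed

end

section \<open>The order on realcompact extensions\<close>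

context hewitt_space
begin

abbreviation ext_rel :: "'a ext \<Rightarrow> ('c \<times> 'c) set" where
  "ext_rel E \<equiv> lim_rel (fst E) (snd E)"

definition ext_class :: "('c \<times> 'c) set \<Rightarrow> 'a ext set" where
  "ext_class E = {e \<in> RC_ext X. ext_rel e = E}"

lemma RC_ext_is_extension: "e \<in> RC_ext X \<Longrightarrow> is_extension X (fst e) (snd e)"
  by (auto simp: RC_ext_def)

lemma ext_rel_adm: "e \<in> RC_ext X \<Longrightarrow> ext_rel e \<in> adm"
  using lim_rel_adm[of "fst e" "snd e"] by simp

lemma ext_class_nonempty:
  assumes "E \<in> adm"
  obtains e where "e \<in> RC_ext X" "ext_rel e = E"
proof -
  obtain T f where "(T, f) \<in> RC_ext X" "lim_rel T f = E"
    by (rule adm_realized[OF assms])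
  then show ?thesis using that[of "(T, f)"] by simp
qed

lemma ext_equiv_class:
  assumes "e \<in> RC_ext X"
  shows "(ext_equiv X \<inter> RC_ext X \<times> RC_ext X) `` {e} = ext_class (ext_rel e)"
proof -
  have "(e, e') \<in> ext_equiv X \<longleftrightarrow> ext_rel e' = ext_rel e" if "e' \<in> RC_ext X" for e'
    using extension_homeomorphism_iff_lim_rel_eq[OF RC_ext_is_extension[OF assms] RC_ext_is_extension[OF that]]
    by (simp add: ext_equiv_def case_prod_unfold)
  then show ?thesis
    using assms by (auto simp: ext_class_def)
qed

lemma RC_classes_eq: "RC_classes X = ext_class ` adm"
proof -
  have "RC_classes X = (\<lambda>e. ext_class (ext_rel e)) ` RC_ext X"
    unfolding RC_classes_def quotient_def using ext_equiv_class by auto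
  also have "\<dots> = ext_class ` adm"
  proof -
    have "ext_rel ` RC_ext X = adm"
    proof (intro equalityI subsetI)
      fix E assume "E \<in> adm"
      from ext_class_nonempty[OF this] show "E \<in> ext_rel ` RC_ext X" by blast
    qed (use ext_rel_adm in blast)
    then show ?thesis by (metis image_image)
  qed
  finally show ?thesis .
qed

lemma inj_on_ext_class: "inj_on ext_class adm"
proof (rule inj_onI)
  fix E E' assume "E \<in> adm" "E' \<in> adm" and eq: "ext_class E = ext_class E'"
  obtain e where "e \<in> RC_ext X" "ext_rel e = E"
    using ext_class_nonempty[OF \<open>E \<in> adm\<close>] .
  then have "e \<in> ext_class E'" using eq by (auto simp: ext_class_def)
  then show "E = E'" using \<open>ext_rel e = E\<close> by (simp add: ext_class_def)
qed

lemma bij_betw_ext_class: "bij_betw ext_class adm (RC_classes X)"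
  by (simp add: bij_betw_def inj_on_ext_class RC_classes_eq)

text \<open>The relation is constant on a class, so the existential choice of representatives in
  \<open>class_le\<close> is harmless. The order is reversed: a smaller relation identifies less and
  adds fewer points of \<open>B\<close>.\<close>

lemma class_le_ext_class_iff:
  assumes "E \<in> adm" "E' \<in> adm"
  shows "class_le X (ext_class E) (ext_class E') \<longleftrightarrow> E' \<subseteq> E"
proof -
  have le: "ext_le X e e' \<longleftrightarrow> ext_rel e' \<subseteq> ext_rel e" if "e \<in> RC_ext X" "e' \<in> RC_ext X" for e e'
    unfolding ext_le_def
    by (rule extension_map_iff_lim_rel_subset[OF RC_ext_is_extension[OF that(1)] RC_ext_is_extension[OF that(2)]])
  obtain e where e: "e \<in> RC_ext X" "ext_rel e = E"
    using ext_class_nonempty[OF assms(1)] .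
  obtain e' where e': "e' \<in> RC_ext X" "ext_rel e' = E'"
    using ext_class_nonempty[OF assms(2)] .
  show ?thesis
  proof
    assume "class_le X (ext_class E) (ext_class E')"
    then show "E' \<subseteq> E"
      unfolding class_le_def ext_class_def using le by auto
  next
    assume "E' \<subseteq> E"
    then have "ext_le X e e'" using le e e' by simp
    then show "class_le X (ext_class E) (ext_class E')"
      unfolding class_le_def ext_class_def using e e' by blast
  qed
qed

lemma K_subset: "K \<subseteq> topspace B - b ` topspace X"
  using closedin_subset[OF closedin_K] K_disjoint by blast

text \<open>\<open>H\<close> is the field and \<open>D\<close> the part collapsed to one point.
  Empty \<open>D\<close> gives the cheapest relation with a given field; a two-point
  \<open>D\<close> gives a single gluing.\<close>

lemma adm_block:
  assumes H: "closedin B H" "K \<subseteq> H" "H \<inter> b ` topspace X = {}" and D: "closedin B D" "D \<subseteq> H"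
  shows "Id_on H \<union> D \<times> D \<in> adm"
proof -
  have HB: "H \<subseteq> topspace B" using H(1) by (rule closedin_subset)
  have "Id_on H = (\<lambda>x. (x, x)) ` topspace B \<inter> H \<times> H"
    using HB by auto
  then have "closedin (prod_topology B B) (Id_on H)"
    using H(1) Hausdorff_B by (auto intro!: closedin_Int simp: Hausdorff_space_closedin_diagonal closedin_prod_Times_iff)
  then have "closedin (prod_topology B B) (Id_on H \<union> D \<times> D)"
    using D(1) by (intro closedin_Un) (auto simp: closedin_prod_Times_iff)
  moreover have "sym (Id_on H \<union> D \<times> D)" "trans (Id_on H \<union> D \<times> D)"
    using D(2) by (auto simp: sym_def trans_def)
  moreover have "Id_on K \<subseteq> Id_on H \<union> D \<times> D"
    using H(2) by auto
  ultimately show ?thesis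
    unfolding adm_def using HB H(3) D(2) by auto
qed

text \<open>Inside \<open>K \<times> K\<close> the condition \<open>Id_on K \<subseteq> E\<close> is
  exactly reflexivity on \<open>K\<close>.\<close>

lemma closed_equivs_K: "closed_equivs (subtopology B K) = {E \<in> adm. E \<subseteq> K \<times> K}"
proof -
  have top: "topspace (subtopology B K) = K"
    using K_subset by auto
  have cl: "closedin (prod_topology (subtopology B K) (subtopology B K)) E \<longleftrightarrow>
      closedin (prod_topology B B) E \<and> E \<subseteq> K \<times> K" for E
  proof -
    have "closedin (prod_topology B B) (K \<times> K)"
      by (simp add: closedin_prod_Times_iff closedin_K)
    then show ?thesis
      unfolding subtopology_Times[symmetric] by (rule closedin_closed_subtopology)
  qed
  have "E \<in> closed_equivs (subtopology B K) \<longleftrightarrow> E \<in> {E \<in> adm. E \<subseteq> K \<times> K}" for E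
  proof (cases "E \<subseteq> K \<times> K")
    case True
    then have "equiv K E \<longleftrightarrow> sym E \<and> trans E \<and> Id_on K \<subseteq> E"
      by (auto simp: equiv_def refl_on_def)
    moreover have "E \<subseteq> (topspace B - b ` topspace X) \<times> (topspace B - b ` topspace X)"
      using True K_subset by blast
    ultimately show ?thesis
      using True unfolding closed_equivs_def adm_def top mem_Collect_eq cl by simp
  qed (simp add: closed_equivs_def cl)
  then show ?thesis by blast
qed

end

section \<open>An order-theoretic test for relations living on \<open>K\<close>\<close>

definition least_in :: "'a set set \<Rightarrow> 'a set \<Rightarrow> bool" where
  "least_in \<A> A \<longleftrightarrow> (\<forall>Z\<in>\<A>. A \<subseteq> Z)"

text \<open>The minimality clause makes \<open>A\<close> an atom, and in fact the only atom below
  the strictly larger \<open>C\<close>. Everything is phrased by inclusion between members, so order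
  isomorphisms preserve it.\<close>

definition above_unary_step :: "'a set set \<Rightarrow> 'a set \<Rightarrow> bool" where
  "above_unary_step \<A> E \<longleftrightarrow> (\<exists>A\<in>\<A>. \<exists>C\<in>\<A>. A \<subseteq> E \<and> A \<subseteq> C \<and> \<not> C \<subseteq> A \<and> \<not> least_in \<A> A \<and>
     (\<forall>Z\<in>\<A>. \<not> least_in \<A> Z \<and> Z \<subseteq> C \<longrightarrow> A \<subseteq> Z))"

lemma above_unary_step_iso:
  assumes bij: "bij_betw \<psi> \<A> \<B>"
    and mono: "\<And>E E'. \<lbrakk>E \<in> \<A>; E' \<in> \<A>\<rbrakk> \<Longrightarrow> \<psi> E \<subseteq> \<psi> E' \<longleftrightarrow> E \<subseteq> E'"
    and E: "E \<in> \<A>"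
  shows "above_unary_step \<B> (\<psi> E) \<longleftrightarrow> above_unary_step \<A> E"
proof -
  have im: "\<B> = \<psi> ` \<A>" using bij by (simp add: bij_betw_def)
  have least: "least_in \<B> (\<psi> Z) \<longleftrightarrow> least_in \<A> Z" if "Z \<in> \<A>" for Z
    unfolding least_in_def im using mono that by simp
  show ?thesis
    unfolding above_unary_step_def im bex_simps ball_simps
    by (simp add: mono E least[unfolded im] cong: conj_cong ball_cong bex_cong)
qed

context hewitt_space
begin

text \<open>The relations living on \<open>K\<close> are recognised inside the poset: a point \<open>h\<close> outside \<open>K\<close> gives
  the nontrivial relation \<open>Id_on (insert h K)\<close>, and gluing \<open>h\<close> to a point of \<open>K\<close> produces a
  strictly larger relation with no other nontrivial relation below it; no pair of points of \<open>K\<close>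
  has this property.\<close>
lemma above_unary_step_iff:
  assumes E: "E \<in> adm"
  shows "above_unary_step adm E \<longleftrightarrow> \<not> E \<subseteq> K \<times> K"
proof -
  have sub: "Z \<subseteq> (topspace B - b ` topspace X) \<times> (topspace B - b ` topspace X)" and sym: "sym Z" and trans: "trans Z"
    and IdK: "Id_on K \<subseteq> Z" if "Z \<in> adm" for Z
    using that by (auto simp: adm_def)
  have refl: "(p, p) \<in> Z \<and> (q, q) \<in> Z" if "Z \<in> adm" "(p, q) \<in> Z" for Z p q
    using sym[OF that(1)] trans[OF that(1)] that(2) by (meson symD transD)
  have IdK_adm: "Id_on K \<in> adm"
    using adm_block[OF closedin_K subset_refl K_disjoint closedin_empty] by simp
  have least: "least_in adm Z \<longleftrightarrow> Z \<subseteq> Id_on K" if "Z \<in> adm" for Z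
    unfolding least_in_def using IdK_adm IdK that by blast
  have point: "closedin B (insert h K)" "insert h K \<inter> b ` topspace X = {}"
      "Id_on (insert h K) \<in> adm" "\<not> Id_on (insert h K) \<subseteq> Id_on K"
    if h: "h \<in> topspace B - b ` topspace X" "h \<notin> K" for h
  proof -
    show cl: "closedin B (insert h K)"
      using closedin_Un[OF closedin_Hausdorff_singleton[OF Hausdorff_B] closedin_K, of h] h by simp
    show disj: "insert h K \<inter> b ` topspace X = {}"
      using h K_disjoint by blast
    show "Id_on (insert h K) \<in> adm"
      using adm_block[OF cl _ disj closedin_empty] by auto
    show "\<not> Id_on (insert h K) \<subseteq> Id_on K"
      using h by auto
  qed
  have outside: "\<exists>h. h \<in> topspace B - b ` topspace X \<and> h \<notin> K \<and> Id_on (insert h K) \<subseteq> Z"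
    if Z: "Z \<in> adm" "\<not> Z \<subseteq> K \<times> K" for Z
  proof -
    obtain p q where pq: "(p, q) \<in> Z" "(p, q) \<notin> K \<times> K"
      using Z(2) by (meson subrelI)
    then obtain h where h: "(h, h) \<in> Z" "h \<notin> K"
      using refl[OF Z(1) pq(1)] by auto
    then show ?thesis
      using sub[OF Z(1)] IdK[OF Z(1)] by (intro exI[of _ h]) auto
  qed
  show ?thesis
  proof
    assume "\<not> E \<subseteq> K \<times> K"
    then obtain h where h: "h \<in> topspace B - b ` topspace X" "h \<notin> K" "Id_on (insert h K) \<subseteq> E"
      using outside[OF E] by blast
    obtain k where k: "k \<in> K" using K_nonempty by blast
    let ?A = "Id_on (insert h K)" and ?C = "Id_on (insert h K) \<union> {h, k} \<times> {h, k}"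
    have "closedin B {h, k}"
      by (rule closedin_Hausdorff_finite[OF Hausdorff_B]) (use h(1) k K_subset in auto)
    then have C: "?C \<in> adm"
      using adm_block[OF point(1)[OF h(1,2)] _ point(2)[OF h(1,2)]] k by blast
    have A_least: "?A \<subseteq> Z" if Z: "Z \<in> adm" "\<not> least_in adm Z" "Z \<subseteq> ?C" for Z
    proof -
      obtain p q where pq: "(p, q) \<in> Z" "(p, q) \<notin> Id_on K"
        using Z(2) least[OF Z(1)] by (meson subrelI)
      \<comment> \<open>Every pair of \<open>?C\<close> off the diagonal of \<open>K\<close>
        involves \<open>h\<close>, so \<open>Z\<close> contains \<open>(h, h)\<close> and with it
        all of \<open>?A\<close>.\<close>
      then have "p = h \<or> q = h" using Z(3) k by auto
      then have "(h, h) \<in> Z" using refl[OF Z(1) pq(1)] by blast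
      then show ?thesis using IdK[OF Z(1)] by auto
    qed
    have "\<not> least_in adm ?A"
      using least[OF point(3)[OF h(1,2)]] point(4)[OF h(1,2)] by blast
    moreover have "\<not> ?C \<subseteq> ?A" using k h(2) by auto
    moreover have "\<forall>Z\<in>adm. \<not> least_in adm Z \<and> Z \<subseteq> ?C \<longrightarrow> ?A \<subseteq> Z"
      using A_least by simp
    ultimately show "above_unary_step adm E"
      unfolding above_unary_step_def
      by (intro bexI[of _ ?A] bexI[of _ ?C] conjI C point(3)[OF h(1,2)] h(3) Un_upper1)
  next
    assume "above_unary_step adm E"
    then obtain A C where AC: "A \<in> adm" "C \<in> adm" "A \<subseteq> E" "A \<subseteq> C" "\<not> C \<subseteq> A"
      and "\<not> least_in adm A" and min': "\<forall>Z\<in>adm. \<not> least_in adm Z \<and> Z \<subseteq> C \<longrightarrow> A \<subseteq> Z"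
      unfolding above_unary_step_def by (elim bexE conjE)
    then have A: "\<not> A \<subseteq> Id_on K"
      using least[OF AC(1)] by simp
    have min: "A \<subseteq> Z" if "Z \<in> adm" "\<not> Z \<subseteq> Id_on K" "Z \<subseteq> C" for Z
      using min' least that by simp
    show "\<not> E \<subseteq> K \<times> K"
    proof
      assume EK: "E \<subseteq> K \<times> K"
      have pair: "Id_on K \<union> {p, q} \<times> {p, q} \<in> adm" if "p \<in> K" "q \<in> K" for p q
      proof -
        have "closedin B {p, q}"
          by (rule closedin_Hausdorff_finite[OF Hausdorff_B]) (use that K_subset in auto)
        then show ?thesis
          using adm_block[OF closedin_K subset_refl K_disjoint] that by blast
      qed
      have pair_sub: "Id_on K \<union> {p, q} \<times> {p, q} \<subseteq> Z" if "Z \<in> adm" "(p, q) \<in> Z" for Z p q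
        using refl[OF that] IdK[OF that(1)] sym[OF that(1)] that(2) by (auto dest: symD)
      obtain p q where pq: "(p, q) \<in> A" "(p, q) \<notin> Id_on K"
        using A by (meson subrelI)
      then have K: "p \<in> K" "q \<in> K" "p \<noteq> q"
        using AC(3) EK by auto
      \<comment> \<open>A point \<open>h\<close> of the field of \<open>C\<close> outside
        \<open>K\<close> would give the nontrivial relation \<open>Id_on (insert h K)\<close> below
        \<open>C\<close>. It would have to contain \<open>A\<close>, but it has no off-diagonal pair
        such as \<open>(p, q)\<close>.\<close>
      have "C \<subseteq> K \<times> K"
      proof (rule ccontr)
        assume "\<not> C \<subseteq> K \<times> K"
        then obtain h where h: "h \<in> topspace B - b ` topspace X" "h \<notin> K" "Id_on (insert h K) \<subseteq> C"
          using outside[OF AC(2)] by blast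
        then have "A \<subseteq> Id_on (insert h K)"
          using min point(3,4) by blast
        then show False using pq K by auto
      qed
      obtain r s where rs: "(r, s) \<in> C" "(r, s) \<notin> A"
        using AC(5) by (meson subrelI)
      then have rsK: "r \<in> K" "s \<in> K" "r \<noteq> s"
        using \<open>C \<subseteq> K \<times> K\<close> IdK[OF AC(1)] by auto
      \<comment> \<open>Gluing just \<open>r\<close> and \<open>s\<close> is a nontrivial relation
        below \<open>C\<close>, so \<open>A\<close> lies below it and is that very gluing, although
        \<open>(r, s)\<close> was chosen outside \<open>A\<close>.\<close>
      have "A \<subseteq> Id_on K \<union> {r, s} \<times> {r, s}"
        using rsK by (intro min pair pair_sub AC(2) rs(1)) auto
      then have "(p, q) = (r, s) \<or> (p, q) = (s, r)"
        using pq K by auto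
      then have "(r, s) \<in> A"
        using pq(1) sym[OF AC(1)] by (auto dest: symD)
      then show False using rs(2) by blast
    qed
  qed
qed

end

theorem theorem3p9:
  fixes X :: "'a topology" and Y :: "'b topology"
    and BX :: "'c topology" and bX :: "'a \<Rightarrow> 'c" and UX :: "'c set"
    and BY :: "'d topology" and bY :: "'b \<Rightarrow> 'd" and UY :: "'d set"
  assumes "completely_regular_space X" "Hausdorff_space X"
    and "completely_regular_space Y" "Hausdorff_space Y"
    and "locally_realcompact X" "\<not> realcompact X"
    and "locally_realcompact Y" "\<not> realcompact Y"
    and "stone_cech X BX bX" "hewitt_in X BX bX UX"
    and "stone_cech Y BY bY" "hewitt_in Y BY bY UY"
    and "RC_order_isomorphic X Y"
  shows "subtopology BX (BX closure_of (UX - bX ` topspace X))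
           homeomorphic_space
         subtopology BY (BY closure_of (UY - bY ` topspace Y))"
proof -
  interpret X: hewitt_space X BX bX UX
    using assms by unfold_locales
  interpret Y: hewitt_space Y BY bY UY
    using assms by unfold_locales
  obtain \<phi> where \<phi>: "bij_betw \<phi> (RC_classes X) (RC_classes Y)"
    "\<And>A B. \<lbrakk>A \<in> RC_classes X; B \<in> RC_classes X\<rbrakk> \<Longrightarrow> class_le X A B \<longleftrightarrow> class_le Y (\<phi> A) (\<phi> B)"
    using assms(13) unfolding RC_order_isomorphic_def by blast
  \<comment> \<open>\<open>\<phi>\<close> moved from classes of extensions to relations. The order
    is reversed on both sides, so \<open>\<psi>\<close> preserves inclusion.\<close>
  define \<psi> where "\<psi> = inv_into Y.adm Y.ext_class \<circ> (\<phi> \<circ> X.ext_class)"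
  have bij: "bij_betw \<psi> X.adm Y.adm"
    unfolding \<psi>_def
    by (rule bij_betw_trans[OF bij_betw_trans[OF X.bij_betw_ext_class \<phi>(1)] bij_betw_inv_into[OF Y.bij_betw_ext_class]])
  have \<psi>: "\<psi> E \<in> Y.adm" "Y.ext_class (\<psi> E) = \<phi> (X.ext_class E)" "X.ext_class E \<in> RC_classes X" if E: "E \<in> X.adm" for E
  proof -
    show "\<psi> E \<in> Y.adm" using bij E by (rule bij_betw_apply)
    show *: "X.ext_class E \<in> RC_classes X"
      using X.bij_betw_ext_class E by (rule bij_betw_apply)
    have "\<phi> (X.ext_class E) \<in> RC_classes Y"
      using \<phi>(1) * by (rule bij_betw_apply)
    then show "Y.ext_class (\<psi> E) = \<phi> (X.ext_class E)"
      unfolding \<psi>_def using Y.bij_betw_ext_class by (simp add: bij_betw_inv_into_right)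
  qed
  have mono: "\<psi> E \<subseteq> \<psi> E' \<longleftrightarrow> E \<subseteq> E'" if "E \<in> X.adm" "E' \<in> X.adm" for E E'
    using Y.class_le_ext_class_iff[of "\<psi> E'" "\<psi> E"] X.class_le_ext_class_iff[of E' E]
      \<phi>(2)[of "X.ext_class E'" "X.ext_class E"] \<psi> that by simp
  \<comment> \<open>This is what lets \<open>\<psi>\<close> restrict to the closed equivalence
    relations on the two sets \<open>K\<close>.\<close>
  have pure: "\<psi> E \<subseteq> Y.K \<times> Y.K \<longleftrightarrow> E \<subseteq> X.K \<times> X.K" if "E \<in> X.adm" for E
    using above_unary_step_iso[OF bij mono that] X.above_unary_step_iff[OF that]
      Y.above_unary_step_iff[OF \<psi>(1)[OF that]] by blast
  have bij_K: "bij_betw \<psi> (closed_equivs (subtopology BX X.K)) (closed_equivs (subtopology BY Y.K))"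
    unfolding X.closed_equivs_K Y.closed_equivs_K
  proof (rule bij_betw_imageI)
    show "inj_on \<psi> {E \<in> X.adm. E \<subseteq> X.K \<times> X.K}"
      using bij by (auto simp: bij_betw_def inj_on_def)
    show "\<psi> ` {E \<in> X.adm. E \<subseteq> X.K \<times> X.K} = {E \<in> Y.adm. E \<subseteq> Y.K \<times> Y.K}"
    proof (intro equalityI subsetI)
      fix E' assume E': "E' \<in> {E \<in> Y.adm. E \<subseteq> Y.K \<times> Y.K}"
      then obtain E where "E \<in> X.adm" "E' = \<psi> E"
        using bij unfolding bij_betw_def by blast
      then show "E' \<in> \<psi> ` {E \<in> X.adm. E \<subseteq> X.K \<times> X.K}"
        using E' pure by simp
    qed (use pure \<psi>(1) in auto)
  qed
  interpret closed_equivs_iso "subtopology BX X.K" "subtopology BY Y.K" \<psi>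
  proof
    show "Hausdorff_space (subtopology BX X.K)" "Hausdorff_space (subtopology BY Y.K)"
      by (simp_all add: Hausdorff_space_subtopology X.Hausdorff_B Y.Hausdorff_B)
  qed (use bij_K mono X.closed_equivs_K in auto)
  have "topspace (subtopology BX X.K) \<noteq> {}" "topspace (subtopology BY Y.K) \<noteq> {}"
    using X.K_nonempty X.K_subset Y.K_nonempty Y.K_subset by auto
  then show ?thesis
    using homeomorphic unfolding X.K_def Y.K_def by blast
qed

end
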